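(* There exists a 2-category, denoted $\mathsf{Cat}\ltimes^\ell\mathsf{Cat}$, whose objects are the triples $(\mathcal A,\mathcal X,F)$ with $F:\mathcal A\times\mathcal X\to\mathcal X$ a functor (a parametrized endofunctor), whose 1-cells are oplax morphisms of algebras, and whose 2-cells are pairs of compatible natural transformations, so that the assignment $(\mathcal A,\mathcal X,F)\mapsto\mathcal A\ltimes^F\mathcal X$ is a 2-functor $\mathsf{Cat}\ltimes^\ell\mathsf{Cat}\to\mathsf{Cat}$.
   Context: **Total category of the fibration of endofunctor algebras.** For a functor $F:\mathcal A\times\mathcal X\to\mathcal X$, write $F_A=F(A,-)$. The category $\mathcal A\ltimes^F\mathcal X$ has as objects triples $(A,X,\xi)$ with $A\in\mathcal A$, $X\in\mathcal X$ and $\xi:F_AX\to X$ any morphism; a morphism $(A,X,\xi)\to(B,Y,\theta)$ is a pair $(f:A\to B,\ g:X\to Y)$ with $g\circ\xi=\theta\circ F(f,g)$. Composition and identities are componentwise. **The 2-category $\mathsf{Cat}\ltimes^\ell\mathsf{Cat}$.** - Objects: triples $(\mathcal A,\mathcal X,F)$ as in the claim. - 1-cells $(\mathcal A,\mathcal X,F)\to(\mathcal B,\mathcal Y,G)$: triples $(U,V,\delta)$ with $U:\mathcal A\to\mathcal B$ and $V:\mathcal X\to\mathcal Y$ functors and $\delta:G\circ(U\times V)\Rightarrow V\circ F$ a natural transformation, with components $\delta_{AX}:G_{UA}VX\to VF_AX$. Composition is by pasting. - 2-cells $(U,V,\delta)\Rightarrow(U',V',\delta')$: pairs of natural transformations $\omega:U\Rightarrow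 U'$, $\nu:V\Rightarrow V'$ such that $\nu_{F_AX}\circ\delta_{AX}=\delta'_{AX}\circ G(\omega_A,\nu_X)$ for all $A,X$. **Action of the assignment on cells.** A 1-cell $(U,V,\delta)$ is sent to the functor $\mathcal A\ltimes^F\mathcal X\to\mathcal B\ltimes^G\mathcal Y$ given by $(A,X,\xi)\mapsto(UA,VX,V\xi\circ\delta_{AX})$ and $(f,g)\mapsto(Uf,Vg)$. A 2-cell $(\omega,\nu)$ is sent to the natural transformation with component $(\omega_A,\nu_X)$ at $(A,X,\xi)$. *)

theory Defs
  imports Main "HOL-Library.FuncSet"
begin

text \<open>
  Conventions. Categories have explicit carriers for objects and arrows; as in HOL-Algebra, the
  values of the operations outside the carriers are irrelevant. Functors and natural
  transformations, which have to be compared for equality, are given by maps that are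
  \<^const>\<open>undefined\<close> outside their carriers (\<^term>\<open>extensional\<close>), so that two of them are equal as
  terms iff they agree on the carriers. Composites are written in the order of function
  application: \<open>Comp C g f\<close> is \<open>g\<close> after \<open>f\<close>.
\<close>

section \<open>Categories, functors, natural transformations\<close>

record ('o, 'a) cat =
  Obj :: "'o set"
  Arr :: "'a set"
  Dom :: "'a \<Rightarrow> 'o"
  Cod :: "'a \<Rightarrow> 'o"
  Id :: "'o \<Rightarrow> 'a"
  Comp :: "'a \<Rightarrow> 'a \<Rightarrow> 'a"

definition hom :: "('o, 'a) cat \<Rightarrow> 'o \<Rightarrow> 'o \<Rightarrow> 'a set" where
  "hom C x y = {f \<in> Arr C. Dom C f = x \<and> Cod C f = y}"

locale category =
  fixes C :: "('o, 'a) cat"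
  assumes dom_obj: "f \<in> Arr C \<Longrightarrow> Dom C f \<in> Obj C"
    and cod_obj: "f \<in> Arr C \<Longrightarrow> Cod C f \<in> Obj C"
    and id_hom: "x \<in> Obj C \<Longrightarrow> Id C x \<in> hom C x x"
    and comp_hom: "\<lbrakk>f \<in> hom C x y; g \<in> hom C y z\<rbrakk> \<Longrightarrow> Comp C g f \<in> hom C x z"
    and comp_id_right: "f \<in> hom C x y \<Longrightarrow> Comp C f (Id C x) = f"
    and comp_id_left: "f \<in> hom C x y \<Longrightarrow> Comp C (Id C y) f = f"
    and comp_assoc: "\<lbrakk>f \<in> hom C w x; g \<in> hom C x y; h \<in> hom C y z\<rbrakk>
      \<Longrightarrow> Comp C h (Comp C g f) = Comp C (Comp C h g) f"

record ('o, 'a, 'p, 'b) fctr =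
  FObj :: "'o \<Rightarrow> 'p"
  FArr :: "'a \<Rightarrow> 'b"

locale cat_functor = A: category A + B: category B
  for A :: "('o, 'a) cat" and B :: "('p, 'b) cat" +
  fixes F :: "('o, 'a, 'p, 'b) fctr"
  assumes obj_map: "FObj F \<in> Obj A \<rightarrow>\<^sub>E Obj B"
    and arr_map: "FArr F \<in> Arr A \<rightarrow>\<^sub>E Arr B"
    and map_hom: "f \<in> hom A x y \<Longrightarrow> FArr F f \<in> hom B (FObj F x) (FObj F y)"
    and map_id: "x \<in> Obj A \<Longrightarrow> FArr F (Id A x) = Id B (FObj F x)"
    and map_comp: "\<lbrakk>f \<in> hom A x y; g \<in> hom A y z\<rbrakk>
      \<Longrightarrow> FArr F (Comp A g f) = Comp B (FArr F g) (FArr F f)"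

locale nat_trans = F: cat_functor A B F + G: cat_functor A B G
  for A :: "('o, 'a) cat" and B :: "('p, 'b) cat" and F G +
  fixes \<tau> :: "'o \<Rightarrow> 'b"
  assumes components_extensional: "\<tau> \<in> extensional (Obj A)"
    and component: "x \<in> Obj A \<Longrightarrow> \<tau> x \<in> hom B (FObj F x) (FObj G x)"
    and naturality: "f \<in> hom A x y \<Longrightarrow> Comp B (\<tau> y) (FArr F f) = Comp B (FArr G f) (\<tau> x)"

definition id_fctr :: "('o, 'a) cat \<Rightarrow> ('o, 'a, 'o, 'a) fctr" where
  "id_fctr A = \<lparr>FObj = (\<lambda>x \<in> Obj A. x), FArr = (\<lambda>f \<in> Arr A. f)\<rparr>"

text \<open>\<open>comp_fctr A G F\<close> is \<open>G\<close> after \<open>F\<close>, where \<open>A\<close> is the domain of \<open>F\<close>.\<close>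

definition comp_fctr ::
  "('o, 'a) cat \<Rightarrow> ('p, 'b, 'q, 'c) fctr \<Rightarrow> ('o, 'a, 'p, 'b) fctr \<Rightarrow> ('o, 'a, 'q, 'c) fctr" where
  "comp_fctr A G F =
    \<lparr>FObj = compose (Obj A) (FObj G) (FObj F), FArr = compose (Arr A) (FArr G) (FArr F)\<rparr>"

definition prod_cat :: "('o, 'a) cat \<Rightarrow> ('p, 'b) cat \<Rightarrow> ('o \<times> 'p, 'a \<times> 'b) cat" where
  "prod_cat A B =
    \<lparr>Obj = Obj A \<times> Obj B,
     Arr = Arr A \<times> Arr B,
     Dom = map_prod (Dom A) (Dom B),
     Cod = map_prod (Cod A) (Cod B),
     Id = map_prod (Id A) (Id B),
     Comp = (\<lambda>(f', g') (f, g). (Comp A f' f, Comp B g' g))\<rparr>"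

text \<open>\<open>prod_fctr A X U V\<close> is \<open>U \<times> V\<close>, where \<open>A\<close> and \<open>X\<close> are the domains of \<open>U\<close> and \<open>V\<close>.\<close>

definition prod_fctr ::
  "('o, 'a) cat \<Rightarrow> ('p, 'b) cat \<Rightarrow> ('o, 'a, 'q, 'c) fctr \<Rightarrow> ('p, 'b, 'r, 'd) fctr \<Rightarrow>
    ('o \<times> 'p, 'a \<times> 'b, 'q \<times> 'r, 'c \<times> 'd) fctr" where
  "prod_fctr A X U V =
    \<lparr>FObj = restrict (map_prod (FObj U) (FObj V)) (Obj A \<times> Obj X),
     FArr = restrict (map_prod (FArr U) (FArr V)) (Arr A \<times> Arr X)\<rparr>"

text \<open>
  A category presented by its hom-sets: \<open>H x d y\<close> states that \<open>d\<close> is an arrow from \<open>x\<close> to \<open>y\<close>.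
  The hom-sets need not be disjoint, so an arrow carries its domain and codomain:
  it is a triple \<open>(x, d, y)\<close>.
\<close>

definition hom_presented ::
  "'o set \<Rightarrow> ('o \<Rightarrow> 'd \<Rightarrow> 'o \<Rightarrow> bool) \<Rightarrow> ('o \<Rightarrow> 'd) \<Rightarrow> ('d \<Rightarrow> 'd \<Rightarrow> 'd) \<Rightarrow> ('o, 'o \<times> 'd \<times> 'o) cat"
where
  "hom_presented S H i c =
    \<lparr>Obj = S,
     Arr = {(x, d, y). x \<in> S \<and> y \<in> S \<and> H x d y},
     Dom = (\<lambda>(x, d, y). x),
     Cod = (\<lambda>(x, d, y). y),
     Id = (\<lambda>x. (x, i x, x)),
     Comp = (\<lambda>(y', e, z) (x, d, y). (x, c e d, z))\<rparr>"

type_synonym ('o, 'a, 'p, 'b) ntrans =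
  "('o, 'a, 'p, 'b) fctr \<times> ('o \<Rightarrow> 'b) \<times> ('o, 'a, 'p, 'b) fctr"

definition vert_comp ::
  "('o, 'a) cat \<Rightarrow> ('p, 'b) cat \<Rightarrow> ('o \<Rightarrow> 'b) \<Rightarrow> ('o \<Rightarrow> 'b) \<Rightarrow> ('o \<Rightarrow> 'b)" where
  "vert_comp A B \<sigma> \<tau> = (\<lambda>x \<in> Obj A. Comp B (\<sigma> x) (\<tau> x))"

definition fctr_cat ::
  "('o, 'a) cat \<Rightarrow> ('p, 'b) cat \<Rightarrow> (('o, 'a, 'p, 'b) fctr, ('o, 'a, 'p, 'b) ntrans) cat" where
  "fctr_cat A B = hom_presented
    {F. cat_functor A B F}
    (\<lambda>F \<tau> G. nat_trans A B F G \<tau>)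
    (\<lambda>F. \<lambda>x \<in> Obj A. Id B (FObj F x))
    (vert_comp A B)"

text \<open>
  Horizontal (Godement) composite \<open>\<sigma> * \<tau> : G \<circ> F \<Rightarrow> G' \<circ> F'\<close> of \<open>\<tau> : F \<Rightarrow> F'\<close> (functors with
  domain \<open>A\<close>) and \<open>\<sigma> : G \<Rightarrow> G'\<close> (functors with codomain \<open>C\<close>).
\<close>

definition horiz_comp ::
  "('o, 'a) cat \<Rightarrow> ('q, 'c) cat \<Rightarrow> ('p, 'b, 'q, 'c) fctr \<Rightarrow> ('p \<Rightarrow> 'c) \<Rightarrow>
    ('o, 'a, 'p, 'b) fctr \<Rightarrow> ('o \<Rightarrow> 'b) \<Rightarrow> ('o \<Rightarrow> 'c)" where
  "horiz_comp A C G \<sigma> F' \<tau> = (\<lambda>x \<in> Obj A. Comp C (\<sigma> (FObj F' x)) (FArr G (\<tau> x)))"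

section \<open>Strict 2-categories and 2-functors\<close>

text \<open>
  2-categories in the \<open>Cat\<close>-enriched form: \<open>HComp K A B C\<close> is the composition functor
  \<open>Hom2 K B C \<times> Hom2 K A B \<rightarrow> Hom2 K A C\<close>. Its object map composes 1-cells, its arrow map composes
  2-cells horizontally; vertical composition is the composition of the hom-categories.
\<close>

record ('o, 'm, 'c) two_cat =
  Obj2 :: "'o set"
  Hom2 :: "'o \<Rightarrow> 'o \<Rightarrow> ('m, 'c) cat"
  Unit2 :: "'o \<Rightarrow> 'm"
  HComp :: "'o \<Rightarrow> 'o \<Rightarrow> 'o \<Rightarrow> ('m \<times> 'm, 'c \<times> 'c, 'm, 'c) fctr"

locale two_category =
  fixes K :: "('o, 'm, 'c) two_cat"
  assumes hom_category: "\<lbrakk>A \<in> Obj2 K; B \<in> Obj2 K\<rbrakk> \<Longrightarrow> category (Hom2 K A B)"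
    and unit_obj: "A \<in> Obj2 K \<Longrightarrow> Unit2 K A \<in> Obj (Hom2 K A A)"
    and hcomp_functor: "\<lbrakk>A \<in> Obj2 K; B \<in> Obj2 K; C \<in> Obj2 K\<rbrakk>
      \<Longrightarrow> cat_functor (prod_cat (Hom2 K B C) (Hom2 K A B)) (Hom2 K A C) (HComp K A B C)"
    and hcomp_assoc_obj:
      "\<lbrakk>A \<in> Obj2 K; B \<in> Obj2 K; C \<in> Obj2 K; D \<in> Obj2 K;
        f \<in> Obj (Hom2 K A B); g \<in> Obj (Hom2 K B C); h \<in> Obj (Hom2 K C D)\<rbrakk>
      \<Longrightarrow> FObj (HComp K A C D) (h, FObj (HComp K A B C) (g, f)) =
          FObj (HComp K A B D) (FObj (HComp K B C D) (h, g), f)"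
    and hcomp_assoc_arr:
      "\<lbrakk>A \<in> Obj2 K; B \<in> Obj2 K; C \<in> Obj2 K; D \<in> Obj2 K;
        \<alpha> \<in> Arr (Hom2 K A B); \<beta> \<in> Arr (Hom2 K B C); \<gamma> \<in> Arr (Hom2 K C D)\<rbrakk>
      \<Longrightarrow> FArr (HComp K A C D) (\<gamma>, FArr (HComp K A B C) (\<beta>, \<alpha>)) =
          FArr (HComp K A B D) (FArr (HComp K B C D) (\<gamma>, \<beta>), \<alpha>)"
    and hcomp_unit_right_obj: "\<lbrakk>A \<in> Obj2 K; B \<in> Obj2 K; f \<in> Obj (Hom2 K A B)\<rbrakk>
      \<Longrightarrow> FObj (HComp K A A B) (f, Unit2 K A) = f"
    and hcomp_unit_right_arr: "\<lbrakk>A \<in> Obj2 K; B \<in> Obj2 K; \<alpha> \<in> Arr (Hom2 K A B)\<rbrakk>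
      \<Longrightarrow> FArr (HComp K A A B) (\<alpha>, Id (Hom2 K A A) (Unit2 K A)) = \<alpha>"
    and hcomp_unit_left_obj: "\<lbrakk>A \<in> Obj2 K; B \<in> Obj2 K; f \<in> Obj (Hom2 K A B)\<rbrakk>
      \<Longrightarrow> FObj (HComp K A B B) (Unit2 K B, f) = f"
    and hcomp_unit_left_arr: "\<lbrakk>A \<in> Obj2 K; B \<in> Obj2 K; \<alpha> \<in> Arr (Hom2 K A B)\<rbrakk>
      \<Longrightarrow> FArr (HComp K A B B) (Id (Hom2 K B B) (Unit2 K B), \<alpha>) = \<alpha>"

record ('o, 'm, 'c, 'p, 'n, 'd) two_fctr =
  TObj :: "'o \<Rightarrow> 'p"
  THom :: "'o \<Rightarrow> 'o \<Rightarrow> ('m, 'c, 'n, 'd) fctr"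

locale two_functor = K: two_category K + L: two_category L
  for K :: "('o, 'm, 'c) two_cat" and L :: "('p, 'n, 'd) two_cat" +
  fixes T :: "('o, 'm, 'c, 'p, 'n, 'd) two_fctr"
  assumes tobj: "A \<in> Obj2 K \<Longrightarrow> TObj T A \<in> Obj2 L"
    and thom_functor: "\<lbrakk>A \<in> Obj2 K; B \<in> Obj2 K\<rbrakk>
      \<Longrightarrow> cat_functor (Hom2 K A B) (Hom2 L (TObj T A) (TObj T B)) (THom T A B)"
    and thom_unit: "A \<in> Obj2 K \<Longrightarrow> FObj (THom T A A) (Unit2 K A) = Unit2 L (TObj T A)"
    and thom_hcomp_obj:
      "\<lbrakk>A \<in> Obj2 K; B \<in> Obj2 K; C \<in> Obj2 K; f \<in> Obj (Hom2 K A B); g \<in> Obj (Hom2 K B C)\<rbrakk>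
      \<Longrightarrow> FObj (THom T A C) (FObj (HComp K A B C) (g, f)) =
          FObj (HComp L (TObj T A) (TObj T B) (TObj T C)) (FObj (THom T B C) g, FObj (THom T A B) f)"
    and thom_hcomp_arr:
      "\<lbrakk>A \<in> Obj2 K; B \<in> Obj2 K; C \<in> Obj2 K; \<alpha> \<in> Arr (Hom2 K A B); \<beta> \<in> Arr (Hom2 K B C)\<rbrakk>
      \<Longrightarrow> FArr (THom T A C) (FArr (HComp K A B C) (\<beta>, \<alpha>)) =
          FArr (HComp L (TObj T A) (TObj T B) (TObj T C)) (FArr (THom T B C) \<beta>, FArr (THom T A B) \<alpha>)"

text \<open>
  The 2-category of all categories whose objects and arrows are drawn from given types
  \<open>'o\<close> and \<open>'a\<close>; the types play the role of the universe that bounds the size.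
\<close>

definition Cat :: "(('o, 'a) cat, ('o, 'a, 'o, 'a) fctr, ('o, 'a, 'o, 'a) ntrans) two_cat" where
  "Cat =
    \<lparr>Obj2 = {A. category A},
     Hom2 = fctr_cat,
     Unit2 = id_fctr,
     HComp = (\<lambda>A B C.
       \<lparr>FObj = (\<lambda>(G, F) \<in> Obj (fctr_cat B C) \<times> Obj (fctr_cat A B). comp_fctr A G F),
        FArr = (\<lambda>((G, \<sigma>, G'), (F, \<tau>, F')) \<in> Arr (fctr_cat B C) \<times> Arr (fctr_cat A B).
          (comp_fctr A G F, horiz_comp A C G \<sigma> F' \<tau>, comp_fctr A G' F'))\<rparr>)\<rparr>"

section \<open>Parametrized endofunctors with oplax morphisms of algebras\<close>

type_synonym ('oa, 'aa, 'ox, 'ax) param_endo =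
  "('oa, 'aa) cat \<times> ('ox, 'ax) cat \<times> ('oa \<times> 'ox, 'aa \<times> 'ax, 'ox, 'ax) fctr"

type_synonym ('oa, 'aa, 'ox, 'ax) oplax =
  "('oa, 'aa, 'oa, 'aa) fctr \<times> ('ox, 'ax, 'ox, 'ax) fctr \<times> ('oa \<times> 'ox \<Rightarrow> 'ax)"

type_synonym ('oa, 'aa, 'ox, 'ax) oplax_2cell =
  "('oa, 'aa, 'ox, 'ax) oplax \<times> (('oa \<Rightarrow> 'aa) \<times> ('ox \<Rightarrow> 'ax)) \<times> ('oa, 'aa, 'ox, 'ax) oplax"

definition param_endos :: "('oa, 'aa, 'ox, 'ax) param_endo set" where
  "param_endos = {(A, X, F). category A \<and> category X \<and> cat_functor (prod_cat A X) X F}"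

fun is_oplax ::
  "('oa, 'aa, 'ox, 'ax) param_endo \<Rightarrow> ('oa, 'aa, 'ox, 'ax) param_endo \<Rightarrow>
    ('oa, 'aa, 'ox, 'ax) oplax \<Rightarrow> bool" where
  "is_oplax (A, X, F) (B, Y, G) (U, V, \<delta>) \<longleftrightarrow>
    cat_functor A B U \<and> cat_functor X Y V \<and>
    nat_trans (prod_cat A X) Y
      (comp_fctr (prod_cat A X) G (prod_fctr A X U V)) (comp_fctr (prod_cat A X) V F) \<delta>"

fun is_oplax_2cell ::
  "('oa, 'aa, 'ox, 'ax) param_endo \<Rightarrow> ('oa, 'aa, 'ox, 'ax) param_endo \<Rightarrow>
    ('oa, 'aa, 'ox, 'ax) oplax \<Rightarrow> ('oa \<Rightarrow> 'aa) \<times> ('ox \<Rightarrow> 'ax) \<Rightarrow>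
    ('oa, 'aa, 'ox, 'ax) oplax \<Rightarrow> bool" where
  "is_oplax_2cell (A, X, F) (B, Y, G) (U, V, \<delta>) (\<omega>, \<nu>) (U', V', \<delta>') \<longleftrightarrow>
    nat_trans A B U U' \<omega> \<and> nat_trans X Y V V' \<nu> \<and>
    (\<forall>a \<in> Obj A. \<forall>x \<in> Obj X.
      Comp Y (\<nu> (FObj F (a, x))) (\<delta> (a, x)) = Comp Y (\<delta>' (a, x)) (FArr G (\<omega> a, \<nu> x)))"

fun oplax_id :: "('oa, 'aa, 'ox, 'ax) param_endo \<Rightarrow> ('oa, 'aa, 'ox, 'ax) oplax" where
  "oplax_id (A, X, F) =
    (id_fctr A, id_fctr X, \<lambda>(a, x) \<in> Obj A \<times> Obj X. Id X (FObj F (a, x)))"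

text \<open>
  Pasting: the composite of \<open>(U, V, \<delta>) : (A, X, F) \<rightarrow> (B, Y, G)\<close> with
  \<open>(U', V', \<delta>') : (B, Y, G) \<rightarrow> (C, Z, H)\<close> has the 2-cell
  \<open>V' \<delta> \<circ> \<delta>' (U \<times> V) : H (U' U \<times> V' V) \<Rightarrow> V' G (U \<times> V) \<Rightarrow> V' V F\<close>.
\<close>

fun oplax_comp ::
  "('oa, 'aa, 'ox, 'ax) param_endo \<Rightarrow> ('oa, 'aa, 'ox, 'ax) param_endo \<Rightarrow>
    ('oa, 'aa, 'ox, 'ax) oplax \<Rightarrow> ('oa, 'aa, 'ox, 'ax) oplax \<Rightarrow> ('oa, 'aa, 'ox, 'ax) oplax" where
  "oplax_comp (A, X, F) (C, Z, H) (U', V', \<delta>') (U, V, \<delta>) =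
    (comp_fctr A U' U, comp_fctr X V' V,
     \<lambda>(a, x) \<in> Obj A \<times> Obj X. Comp Z (FArr V' (\<delta> (a, x))) (\<delta>' (FObj U a, FObj V x)))"

fun oplax_hom ::
  "('oa, 'aa, 'ox, 'ax) param_endo \<Rightarrow> ('oa, 'aa, 'ox, 'ax) param_endo \<Rightarrow>
    (('oa, 'aa, 'ox, 'ax) oplax, ('oa, 'aa, 'ox, 'ax) oplax_2cell) cat" where
  "oplax_hom (A, X, F) (B, Y, G) = hom_presented
    {M. is_oplax (A, X, F) (B, Y, G) M}
    (is_oplax_2cell (A, X, F) (B, Y, G))
    (\<lambda>(U, V, \<delta>). (\<lambda>a \<in> Obj A. Id B (FObj U a), \<lambda>x \<in> Obj X. Id Y (FObj V x)))
    (\<lambda>(\<omega>', \<nu>') (\<omega>, \<nu>). (vert_comp A B \<omega>' \<omega>, vert_comp X Y \<nu>' \<nu>))"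

fun oplax_hcomp_2cell ::
  "('oa, 'aa, 'ox, 'ax) param_endo \<Rightarrow> ('oa, 'aa, 'ox, 'ax) param_endo \<Rightarrow>
    ('oa, 'aa, 'ox, 'ax) oplax_2cell \<Rightarrow> ('oa, 'aa, 'ox, 'ax) oplax_2cell \<Rightarrow>
    ('oa, 'aa, 'ox, 'ax) oplax_2cell" where
  "oplax_hcomp_2cell (A, X, F) (C, Z, H)
     ((P, Q, \<epsilon>), (\<psi>, \<chi>), (P', Q', \<epsilon>')) ((U, V, \<delta>), (\<omega>, \<nu>), (U', V', \<delta>')) =
    (oplax_comp (A, X, F) (C, Z, H) (P, Q, \<epsilon>) (U, V, \<delta>),
     (horiz_comp A C P \<psi> U' \<omega>, horiz_comp X Z Q \<chi> V' \<nu>),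
     oplax_comp (A, X, F) (C, Z, H) (P', Q', \<epsilon>') (U', V', \<delta>'))"

text \<open>
  \<open>CatCat\<close> renders \<open>Cat \<ltimes>\<^sup>l Cat\<close>. The parameter categories and the categories they act on may have
  different object and arrow types.
\<close>

definition CatCat ::
  "(('oa, 'aa, 'ox, 'ax) param_endo, ('oa, 'aa, 'ox, 'ax) oplax,
    ('oa, 'aa, 'ox, 'ax) oplax_2cell) two_cat" where
  "CatCat =
    \<lparr>Obj2 = param_endos,
     Hom2 = oplax_hom,
     Unit2 = oplax_id,
     HComp = (\<lambda>K L M.
       \<lparr>FObj = (\<lambda>(N', N) \<in> Obj (oplax_hom L M) \<times> Obj (oplax_hom K L). oplax_comp K M N' N),
        FArr = (\<lambda>(\<beta>, \<alpha>) \<in> Arr (oplax_hom L M) \<times> Arr (oplax_hom K L).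
          oplax_hcomp_2cell K M \<beta> \<alpha>)\<rparr>)\<rparr>"

section \<open>The total category of the fibration of endofunctor algebras\<close>

type_synonym ('oa, 'ox, 'ax) alg = "'oa \<times> 'ox \<times> 'ax"

type_synonym ('oa, 'aa, 'ox, 'ax) alg_arr =
  "('oa, 'ox, 'ax) alg \<times> ('aa \<times> 'ax) \<times> ('oa, 'ox, 'ax) alg"

fun total_cat ::
  "('oa, 'aa, 'ox, 'ax) param_endo \<Rightarrow>
    (('oa, 'ox, 'ax) alg, ('oa, 'aa, 'ox, 'ax) alg_arr) cat" where
  "total_cat (A, X, F) = hom_presented
    {(a, x, \<xi>). a \<in> Obj A \<and> x \<in> Obj X \<and> \<xi> \<in> hom X (FObj F (a, x)) x}
    (\<lambda>(a, x, \<xi>) (f, g) (b, y, \<theta>).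
      f \<in> hom A a b \<and> g \<in> hom X x y \<and> Comp X g \<xi> = Comp X \<theta> (FArr F (f, g)))
    (\<lambda>(a, x, \<xi>). (Id A a, Id X x))
    (\<lambda>(f', g') (f, g). (Comp A f' f, Comp X g' g))"

fun total_obj ::
  "('oa, 'aa, 'ox, 'ax) param_endo \<Rightarrow> ('oa, 'aa, 'ox, 'ax) oplax \<Rightarrow>
    ('oa, 'ox, 'ax) alg \<Rightarrow> ('oa, 'ox, 'ax) alg" where
  "total_obj (B, Y, G) (U, V, \<delta>) (a, x, \<xi>) =
    (FObj U a, FObj V x, Comp Y (FArr V \<xi>) (\<delta> (a, x)))"

fun total_arr ::
  "('oa, 'aa, 'ox, 'ax) param_endo \<Rightarrow> ('oa, 'aa, 'ox, 'ax) oplax \<Rightarrow>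
    ('oa, 'aa, 'ox, 'ax) alg_arr \<Rightarrow> ('oa, 'aa, 'ox, 'ax) alg_arr" where
  "total_arr (B, Y, G) (U, V, \<delta>) (s, (f, g), t) =
    (total_obj (B, Y, G) (U, V, \<delta>) s, (FArr U f, FArr V g), total_obj (B, Y, G) (U, V, \<delta>) t)"

definition total_fctr ::
  "('oa, 'aa, 'ox, 'ax) param_endo \<Rightarrow> ('oa, 'aa, 'ox, 'ax) param_endo \<Rightarrow>
    ('oa, 'aa, 'ox, 'ax) oplax \<Rightarrow>
    (('oa, 'ox, 'ax) alg, ('oa, 'aa, 'ox, 'ax) alg_arr,
     ('oa, 'ox, 'ax) alg, ('oa, 'aa, 'ox, 'ax) alg_arr) fctr" where
  "total_fctr K L M =
    \<lparr>FObj = restrict (total_obj L M) (Obj (total_cat K)),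
     FArr = restrict (total_arr L M) (Arr (total_cat K))\<rparr>"

fun total_ntrans ::
  "('oa, 'aa, 'ox, 'ax) param_endo \<Rightarrow> ('oa, 'aa, 'ox, 'ax) param_endo \<Rightarrow>
    ('oa, 'aa, 'ox, 'ax) oplax_2cell \<Rightarrow>
    (('oa, 'ox, 'ax) alg, ('oa, 'aa, 'ox, 'ax) alg_arr,
     ('oa, 'ox, 'ax) alg, ('oa, 'aa, 'ox, 'ax) alg_arr) ntrans" where
  "total_ntrans K L (M, (\<omega>, \<nu>), M') =
    (total_fctr K L M,
     \<lambda>(a, x, \<xi>) \<in> Obj (total_cat K).
       (total_obj L M (a, x, \<xi>), (\<omega> a, \<nu> x), total_obj L M' (a, x, \<xi>)),
     total_fctr K L M')"

text \<open>
  The codomain is \<^const>\<open>Cat\<close> at the types of algebras and of their morphisms: in place of one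
  universe closed under pairing, the source and target use the types that the construction yields.
\<close>

definition total_2functor ::
  "(('oa, 'aa, 'ox, 'ax) param_endo, ('oa, 'aa, 'ox, 'ax) oplax, ('oa, 'aa, 'ox, 'ax) oplax_2cell,
    (('oa, 'ox, 'ax) alg, ('oa, 'aa, 'ox, 'ax) alg_arr) cat,
    (('oa, 'ox, 'ax) alg, ('oa, 'aa, 'ox, 'ax) alg_arr,
     ('oa, 'ox, 'ax) alg, ('oa, 'aa, 'ox, 'ax) alg_arr) fctr,
    (('oa, 'ox, 'ax) alg, ('oa, 'aa, 'ox, 'ax) alg_arr,
     ('oa, 'ox, 'ax) alg, ('oa, 'aa, 'ox, 'ax) alg_arr) ntrans) two_fctr" where
  "total_2functor =
    \<lparr>TObj = total_cat,
     THom = (\<lambda>K L.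
       \<lparr>FObj = restrict (total_fctr K L) (Obj (oplax_hom K L)),
        FArr = restrict (total_ntrans K L) (Arr (oplax_hom K L))\<rparr>)\<rparr>"

end

theory Submission
  imports Defs
begin

text \<open>
  A 1-cell of \<open>Cat \<ltimes>\<^sup>l Cat\<close> is a pair of functors \<open>U\<close>, \<open>V\<close> with a transformation \<open>\<delta>\<close>, and a 2-cell is
  a pair of natural transformations \<open>\<omega>\<close>, \<open>\<nu>\<close> subject to an equation. Identities, vertical and
  horizontal composites are formed separately on the two functors and on the two natural
  transformations. Every law of the 2-category between such pairs thus is the same law of the
  2-category of categories, in each coordinate; the interchange law is the only one of these with
  more content than associativity, units and functoriality. Two points are specific to oplax
  morphisms. First, pasting is strictly associative and unital, because functors preserve composites and
  identities (\<open>oplax_comp_assoc\<close>, \<open>oplax_comp_id\<close>). Secondly, both composites of compatible pairs are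
  compatible: vertically by stacking two squares (\<open>oplax_cell_vert_comp\<close>), horizontally, with a
  2-cell \<open>(\<psi>, \<chi>)\<close> whose source is \<open>(P, Q, \<epsilon>)\<close>, by combining both compatibilities with naturality of \<open>\<epsilon>\<close>
  and of \<open>\<chi>\<close> (\<open>oplax_cell_horiz_comp\<close>).

  The functor induced by \<open>(U, V, \<delta>)\<close> carries a structure map \<open>\<xi>\<close> to \<open>V\<xi> \<circ> \<delta>\<close>. It takes algebra morphisms
  to algebra morphisms by naturality of \<open>\<delta>\<close> (\<open>cat_functor_total_fctr\<close>), and the components \<open>(\<omega>, \<nu>)\<close>
  of a 2-cell are algebra morphisms by naturality of \<open>\<nu>\<close> at \<open>\<xi>\<close> and the compatibility equation
  (\<open>nat_trans_total\<close>). An arrow of the total category is a pair with its endpoints, and such arrows are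
  composed as pairs, so equations between the induced transformations reduce to equations of
  endpoints and pairs. When \<open>(U, V, \<delta>)\<close> is followed by a 1-cell
  \<open>(U', V', \<delta>')\<close>, the endpoints agree because the structure maps do, by
  \<open>V'(V\<xi> \<circ> \<delta>) \<circ> \<delta>' = V'V\<xi> \<circ> (V'\<delta> \<circ> \<delta>')\<close> (\<open>total_fctr_comp\<close>); so the assignment preserves composition
  strictly.
\<close>

section \<open>Calculating with arrows\<close>

lemma in_hom_iff: "f \<in> hom C x y \<longleftrightarrow> f \<in> Arr C \<and> Dom C f = x \<and> Cod C f = y"
  by (auto simp: hom_def)

text \<open>Conditions on endpoints are stated as equations between domains and codomains instead of
  memberships in hom-sets, since an equation is decided by rewriting, whereas a hom-set would have
  to be guessed. The rules below bracket every composite to the right and cancel identities.\<close>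

context category
begin

lemmas dom_cod_obj [simp] = dom_obj cod_obj

lemma id_arr [simp]:
  assumes "x \<in> Obj C"
  shows "Id C x \<in> Arr C" "Dom C (Id C x) = x" "Cod C (Id C x) = x"
  using id_hom [OF assms] by (auto simp: in_hom_iff)

lemma comp_arr [simp]:
  assumes "f \<in> Arr C" "g \<in> Arr C" "Dom C g = Cod C f"
  shows "Comp C g f \<in> Arr C" "Dom C (Comp C g f) = Dom C f" "Cod C (Comp C g f) = Cod C g"
  using comp_hom [of f "Dom C f" "Cod C f" g "Cod C g"] assms by (auto simp: in_hom_iff)

lemma comp_id [simp]:
  assumes "f \<in> Arr C"
  shows "x = Dom C f \<Longrightarrow> Comp C f (Id C x) = f" "y = Cod C f \<Longrightarrow> Comp C (Id C y) f = f"
  using comp_id_right [of f] comp_id_left [of f] assms by (auto simp: in_hom_iff)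

lemma comp_assoc_right [simp]:
  assumes "f \<in> Arr C" "g \<in> Arr C" "h \<in> Arr C" "Dom C g = Cod C f" "Dom C h = Cod C g"
  shows "Comp C (Comp C h g) f = Comp C h (Comp C g f)"
  using comp_assoc [of f "Dom C f" "Cod C f" g "Cod C g" h "Cod C h"] assms
  by (auto simp: in_hom_iff)

end

lemma prod_cat_simps [simp]:
  "Obj (prod_cat A B) = Obj A \<times> Obj B"
  "Arr (prod_cat A B) = Arr A \<times> Arr B"
  "Dom (prod_cat A B) (f, g) = (Dom A f, Dom B g)"
  "Cod (prod_cat A B) (f, g) = (Cod A f, Cod B g)"
  "Id (prod_cat A B) (x, y) = (Id A x, Id B y)"
  "Comp (prod_cat A B) (f', g') (f, g) = (Comp A f' f, Comp B g' g)"
  by (auto simp: prod_cat_def)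

lemma category_prod_cat:
  assumes "category A" "category B"
  shows "category (prod_cat A B)"
proof -
  interpret A: category A by fact
  interpret B: category B by fact
  show ?thesis
    by unfold_locales (auto simp: in_hom_iff)
qed

lemma hom_presented_simps [simp]:
  "Obj (hom_presented S H i c) = S"
  "(x, d, y) \<in> Arr (hom_presented S H i c) \<longleftrightarrow> x \<in> S \<and> y \<in> S \<and> H x d y"
  "Dom (hom_presented S H i c) (x, d, y) = x"
  "Cod (hom_presented S H i c) (x, d, y) = y"
  "Id (hom_presented S H i c) x = (x, i x, x)"
  "Comp (hom_presented S H i c) (y', e, z) (x, d, y) = (x, c e d, z)"
  by (auto simp: hom_presented_def)

text \<open>Arrows carry their endpoints, so the laws have to hold only for the data between them; this
  one criterion covers functor categories, the hom-categories of oplax morphisms and the total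
  categories.\<close>

lemma category_hom_presented:
  assumes "\<And>x. x \<in> S \<Longrightarrow> H x (i x) x"
    and "\<And>x y z d e. \<lbrakk>x \<in> S; y \<in> S; z \<in> S; H x d y; H y e z\<rbrakk> \<Longrightarrow> H x (c e d) z"
    and "\<And>x y d. \<lbrakk>x \<in> S; y \<in> S; H x d y\<rbrakk> \<Longrightarrow> c d (i x) = d"
    and "\<And>x y d. \<lbrakk>x \<in> S; y \<in> S; H x d y\<rbrakk> \<Longrightarrow> c (i y) d = d"
    and "\<And>w x y z d e k. \<lbrakk>w \<in> S; x \<in> S; y \<in> S; z \<in> S; H w d x; H x e y; H y k z\<rbrakk>
      \<Longrightarrow> c k (c e d) = c (c k e) d"
  shows "category (hom_presented S H i c)"
  by unfold_locales (auto simp: in_hom_iff intro: assms)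

section \<open>Functors and natural transformations\<close>

lemma cat_functorI:
  assumes "category A" "category B"
    and "FObj F \<in> extensional (Obj A)" "FArr F \<in> extensional (Arr A)"
    and "\<And>x. x \<in> Obj A \<Longrightarrow> FObj F x \<in> Obj B"
    and "\<And>f. f \<in> Arr A \<Longrightarrow> FArr F f \<in> Arr B \<and> Dom B (FArr F f) = FObj F (Dom A f)
      \<and> Cod B (FArr F f) = FObj F (Cod A f)"
    and "\<And>x. x \<in> Obj A \<Longrightarrow> FArr F (Id A x) = Id B (FObj F x)"
    and "\<And>f g. \<lbrakk>f \<in> Arr A; g \<in> Arr A; Dom A g = Cod A f\<rbrakk>
      \<Longrightarrow> FArr F (Comp A g f) = Comp B (FArr F g) (FArr F f)"
  shows "cat_functor A B F"
proof -
  interpret A: category A by fact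
  interpret B: category B by fact
  show ?thesis
    using assms(3-) by unfold_locales (auto simp: in_hom_iff PiE_iff)
qed

context cat_functor
begin

lemma obj [simp]: "x \<in> Obj A \<Longrightarrow> FObj F x \<in> Obj B"
  using obj_map by auto

lemma arr [simp]:
  assumes "f \<in> Arr A"
  shows "FArr F f \<in> Arr B" "Dom B (FArr F f) = FObj F (Dom A f)"
    "Cod B (FArr F f) = FObj F (Cod A f)"
  using map_hom [of f "Dom A f" "Cod A f"] assms by (auto simp: in_hom_iff)

lemma comp [simp]:
  assumes "f \<in> Arr A" "g \<in> Arr A" "Dom A g = Cod A f"
  shows "FArr F (Comp A g f) = Comp B (FArr F g) (FArr F f)"
  using map_comp [of f "Dom A f" "Cod A f" g "Cod A g"] assms by (auto simp: in_hom_iff)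

lemmas id [simp] = map_id

lemma ext: "FObj F \<in> extensional (Obj A)" "FArr F \<in> extensional (Arr A)"
  using obj_map arr_map by (auto simp: PiE_iff)

end

text \<open>Functors are undefined outside their carriers, hence pointwise agreement on the carriers is
  equality of terms. The strict laws for composition of functors come from this.\<close>

lemma cat_functor_eqI:
  fixes F G :: "('o, 'a, 'p, 'b) fctr"
  assumes "cat_functor A B F" "cat_functor A B G"
    and "\<And>x. x \<in> Obj A \<Longrightarrow> FObj F x = FObj G x" "\<And>f. f \<in> Arr A \<Longrightarrow> FArr F f = FArr G f"
  shows "F = G"
proof -
  have "FObj F = FObj G" "FArr F = FArr G"
    using assms by (auto intro!: extensionalityI [of _ "Obj A"] extensionalityI [of _ "Arr A"]
        dest: cat_functor.ext)
  then show ?thesis by (cases F; cases G) simp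
qed

lemma nat_transI:
  assumes "cat_functor A B F" "cat_functor A B G"
    and "\<tau> \<in> extensional (Obj A)"
    and "\<And>x. x \<in> Obj A \<Longrightarrow> \<tau> x \<in> Arr B \<and> Dom B (\<tau> x) = FObj F x \<and> Cod B (\<tau> x) = FObj G x"
    and "\<And>f. f \<in> Arr A
      \<Longrightarrow> Comp B (\<tau> (Cod A f)) (FArr F f) = Comp B (FArr G f) (\<tau> (Dom A f))"
  shows "nat_trans A B F G \<tau>"
proof -
  interpret F: cat_functor A B F by fact
  interpret G: cat_functor A B G by fact
  show ?thesis
    using assms(3-) by unfold_locales (auto simp: in_hom_iff)
qed

context nat_trans
begin

lemma component_arr [simp]:
  assumes "x \<in> Obj A"
  shows "\<tau> x \<in> Arr B" "Dom B (\<tau> x) = FObj F x" "Cod B (\<tau> x) = FObj G x"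
  using component [OF assms] by (auto simp: in_hom_iff)

lemma square:
  assumes "f \<in> Arr A" "Dom A f = x" "Cod A f = y"
  shows "Comp B (\<tau> y) (FArr F f) = Comp B (FArr G f) (\<tau> x)"
  using naturality [of f x y] assms by (simp add: in_hom_iff)

text \<open>The naturality square with a further arrow composed at its source: composites are kept
  bracketed to the right, so this is the form in which the square applies inside them.\<close>

lemma square_comp:
  assumes "f \<in> Arr A" "Dom A f = x" "Cod A f = y" "h \<in> Arr B" "Cod B h = FObj F x"
  shows "Comp B (\<tau> y) (Comp B (FArr F f) h) = Comp B (FArr G f) (Comp B (\<tau> x) h)"
proof -
  have "x \<in> Obj A" "y \<in> Obj A" using assms by auto
  then have "Comp B (\<tau> y) (Comp B (FArr F f) h) = Comp B (Comp B (\<tau> y) (FArr F f)) h"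
    using assms by simp
  also have "\<dots> = Comp B (Comp B (FArr G f) (\<tau> x)) h"
    using assms square by metis
  also have "\<dots> = Comp B (FArr G f) (Comp B (\<tau> x) h)"
    using assms \<open>x \<in> Obj A\<close> by simp
  finally show ?thesis .
qed

end

lemma comp_fctr_simps [simp]:
  "x \<in> Obj A \<Longrightarrow> FObj (comp_fctr A G F) x = FObj G (FObj F x)"
  "f \<in> Arr A \<Longrightarrow> FArr (comp_fctr A G F) f = FArr G (FArr F f)"
  by (auto simp: comp_fctr_def compose_def)

lemma id_fctr_simps [simp]:
  "x \<in> Obj A \<Longrightarrow> FObj (id_fctr A) x = x"
  "f \<in> Arr A \<Longrightarrow> FArr (id_fctr A) f = f"
  by (auto simp: id_fctr_def)

lemma prod_fctr_simps [simp]: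
  "\<lbrakk>a \<in> Obj A; x \<in> Obj X\<rbrakk> \<Longrightarrow> FObj (prod_fctr A X U V) (a, x) = (FObj U a, FObj V x)"
  "\<lbrakk>f \<in> Arr A; g \<in> Arr X\<rbrakk> \<Longrightarrow> FArr (prod_fctr A X U V) (f, g) = (FArr U f, FArr V g)"
  by (auto simp: prod_fctr_def)

lemma cat_functor_id:
  assumes "category A"
  shows "cat_functor A A (id_fctr A)"
proof -
  interpret A: category A by fact
  show ?thesis
    by (rule cat_functorI) (use assms in \<open>auto simp: id_fctr_def\<close>)
qed

lemma cat_functor_comp:
  assumes "cat_functor A B F" "cat_functor B C G"
  shows "cat_functor A C (comp_fctr A G F)"
proof -
  interpret F: cat_functor A B F by fact
  interpret G: cat_functor B C G by fact
  show ?thesis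
    by (rule cat_functorI)
      (auto simp: F.A.category_axioms G.B.category_axioms, auto simp: comp_fctr_def compose_def)
qed

lemma cat_functor_prod:
  assumes "cat_functor A B U" "cat_functor X Y V"
  shows "cat_functor (prod_cat A X) (prod_cat B Y) (prod_fctr A X U V)"
proof -
  interpret U: cat_functor A B U by fact
  interpret V: cat_functor X Y V by fact
  show ?thesis
    by (rule cat_functorI)
      (auto simp: U.A.category_axioms U.B.category_axioms V.A.category_axioms V.B.category_axioms
        category_prod_cat, auto simp: prod_fctr_def)
qed

lemma comp_fctr_assoc:
  assumes "cat_functor A B F" "cat_functor B C G" "cat_functor C D H"
  shows "comp_fctr A H (comp_fctr A G F) = comp_fctr A (comp_fctr B H G) F"
proof (rule cat_functor_eqI)
  interpret F: cat_functor A B F by fact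
  show "cat_functor A D (comp_fctr A H (comp_fctr A G F))"
    "cat_functor A D (comp_fctr A (comp_fctr B H G) F)"
    using assms by (blast intro: cat_functor_comp)+
qed (use assms in \<open>auto simp: cat_functor.obj cat_functor.arr\<close>)

lemma comp_fctr_id:
  assumes "cat_functor A B F"
  shows "comp_fctr A F (id_fctr A) = F" "comp_fctr A (id_fctr B) F = F"
proof -
  interpret F: cat_functor A B F by fact
  have "cat_functor A B (comp_fctr A F (id_fctr A))" "cat_functor A B (comp_fctr A (id_fctr B) F)"
    by (blast intro: cat_functor_comp cat_functor_id assms F.A.category_axioms
        F.B.category_axioms)+
  then show "comp_fctr A F (id_fctr A) = F" "comp_fctr A (id_fctr B) F = F"
    by (auto intro: cat_functor_eqI [OF _ assms])
qed

lemma vert_comp_app [simp]: "x \<in> Obj A \<Longrightarrow> vert_comp A B \<sigma> \<tau> x = Comp B (\<sigma> x) (\<tau> x)"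
  by (simp add: vert_comp_def)

lemma horiz_comp_app [simp]:
  "x \<in> Obj A \<Longrightarrow> horiz_comp A C G \<sigma> F' \<tau> x = Comp C (\<sigma> (FObj F' x)) (FArr G (\<tau> x))"
  by (simp add: horiz_comp_def)

lemma nat_trans_id:
  assumes "cat_functor A B F"
  shows "nat_trans A B F F (\<lambda>x \<in> Obj A. Id B (FObj F x))"
proof -
  interpret F: cat_functor A B F by fact
  show ?thesis by (rule nat_transI) (auto simp: assms)
qed

lemma nat_trans_vert_comp:
  assumes "nat_trans A B F G \<tau>" "nat_trans A B G H \<sigma>"
  shows "nat_trans A B F H (vert_comp A B \<sigma> \<tau>)"
proof -
  interpret \<tau>: nat_trans A B F G \<tau> by fact
  interpret \<sigma>: nat_trans A B G H \<sigma> by fact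
  show ?thesis
    by (rule nat_transI)
      (auto simp: \<tau>.F.cat_functor_axioms \<sigma>.G.cat_functor_axioms \<tau>.square \<sigma>.square_comp,
        auto simp: vert_comp_def)
qed

text \<open>The naturality square pastes the image under \<open>G\<close> of the square of \<open>\<tau>\<close> with the square of
  \<open>\<sigma>\<close> at \<open>F' f\<close>.\<close>

lemma nat_trans_horiz_comp:
  assumes "nat_trans A B F F' \<tau>" "nat_trans B C G G' \<sigma>"
  shows "nat_trans A C (comp_fctr A G F) (comp_fctr A G' F') (horiz_comp A C G \<sigma> F' \<tau>)"
proof -
  interpret \<tau>: nat_trans A B F F' \<tau> by fact
  interpret \<sigma>: nat_trans B C G G' \<sigma> by fact
  have *: "Comp C (FArr G (\<tau> (Cod A f))) (FArr G (FArr F f))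
    = Comp C (FArr G (FArr F' f)) (FArr G (\<tau> (Dom A f)))" if "f \<in> Arr A" for f
    using arg_cong [OF \<tau>.square [OF that refl refl], of "FArr G"] that by simp
  show ?thesis
    by (rule nat_transI)
      (auto simp: cat_functor_comp [OF \<tau>.F.cat_functor_axioms \<sigma>.F.cat_functor_axioms]
        cat_functor_comp [OF \<tau>.G.cat_functor_axioms \<sigma>.G.cat_functor_axioms]
        * \<sigma>.square_comp, auto simp: horiz_comp_def)
qed

lemma vert_comp_id:
  assumes "nat_trans A B F G \<tau>"
  shows "vert_comp A B \<tau> (\<lambda>x \<in> Obj A. Id B (FObj F x)) = \<tau>"
    "vert_comp A B (\<lambda>x \<in> Obj A. Id B (FObj G x)) \<tau> = \<tau>"
proof -
  interpret \<tau>: nat_trans A B F G \<tau> by fact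
  show "vert_comp A B \<tau> (\<lambda>x \<in> Obj A. Id B (FObj F x)) = \<tau>"
    "vert_comp A B (\<lambda>x \<in> Obj A. Id B (FObj G x)) \<tau> = \<tau>"
    by (auto intro!: extensionalityI [of _ "Obj A"] \<tau>.components_extensional simp: vert_comp_def)
qed

lemma vert_comp_assoc:
  assumes "nat_trans A B F G \<tau>" "nat_trans A B G H \<sigma>" "nat_trans A B H K \<rho>"
  shows "vert_comp A B \<rho> (vert_comp A B \<sigma> \<tau>) = vert_comp A B (vert_comp A B \<rho> \<sigma>) \<tau>"
proof -
  interpret \<tau>: nat_trans A B F G \<tau> by fact
  interpret \<sigma>: nat_trans A B G H \<sigma> by fact
  interpret \<rho>: nat_trans A B H K \<rho> by fact
  show ?thesis by (auto simp: vert_comp_def fun_eq_iff)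
qed

text \<open>At \<open>x\<close> the left side is \<open>\<sigma>' \<circ> \<sigma> \<circ> G \<tau>' \<circ> G \<tau>\<close> and the right side is
  \<open>\<sigma>' \<circ> G' \<tau>' \<circ> \<sigma> \<circ> G \<tau>\<close>; naturality of \<open>\<sigma>\<close> at the arrow \<open>\<tau>' x\<close> identifies the middle factors.\<close>

lemma interchange:
  assumes "nat_trans A B F F' \<tau>" "nat_trans A B F' F'' \<tau>'"
    and "nat_trans B C G G' \<sigma>" "nat_trans B C G' G'' \<sigma>'"
  shows "horiz_comp A C G (vert_comp B C \<sigma>' \<sigma>) F'' (vert_comp A B \<tau>' \<tau>)
    = vert_comp A C (horiz_comp A C G' \<sigma>' F'' \<tau>') (horiz_comp A C G \<sigma> F' \<tau>)"
proof -
  interpret \<tau>: nat_trans A B F F' \<tau> by fact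
  interpret \<tau>': nat_trans A B F' F'' \<tau>' by fact
  interpret \<sigma>: nat_trans B C G G' \<sigma> by fact
  interpret \<sigma>': nat_trans B C G' G'' \<sigma>' by fact
  show ?thesis by (auto simp: horiz_comp_def vert_comp_def fun_eq_iff \<sigma>.square_comp)
qed

lemma horiz_comp_id_id:
  assumes "cat_functor A B F" "cat_functor B C G"
  shows "horiz_comp A C G (\<lambda>x \<in> Obj B. Id C (FObj G x)) F (\<lambda>x \<in> Obj A. Id B (FObj F x))
    = (\<lambda>x \<in> Obj A. Id C (FObj (comp_fctr A G F) x))"
proof -
  interpret F: cat_functor A B F by fact
  interpret G: cat_functor B C G by fact
  show ?thesis by (auto simp: horiz_comp_def fun_eq_iff)
qed

lemma horiz_comp_assoc:
  assumes "nat_trans A B F F' \<tau>" "nat_trans B C G G' \<sigma>" "nat_trans C D H H' \<rho>"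
  shows "horiz_comp A D H \<rho> (comp_fctr A G' F') (horiz_comp A C G \<sigma> F' \<tau>)
    = horiz_comp A D (comp_fctr B H G) (horiz_comp B D H \<rho> G' \<sigma>) F' \<tau>"
proof -
  interpret \<tau>: nat_trans A B F F' \<tau> by fact
  interpret \<sigma>: nat_trans B C G G' \<sigma> by fact
  interpret \<rho>: nat_trans C D H H' \<rho> by fact
  show ?thesis by (auto simp: horiz_comp_def fun_eq_iff)
qed

text \<open>The identity 2-cell of \<open>id_fctr A\<close> has the component \<open>Id A (FObj (id_fctr A) x)\<close>, which is
  kept in this form because that is how the unit laws of a 2-category mention it.\<close>

lemma horiz_comp_unit:
  assumes "nat_trans A B F G \<tau>"
  shows "horiz_comp A B F \<tau> (id_fctr A) (\<lambda>x \<in> Obj A. Id A (FObj (id_fctr A) x)) = \<tau>"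
    "horiz_comp A B (id_fctr B) (\<lambda>x \<in> Obj B. Id B (FObj (id_fctr B) x)) G \<tau> = \<tau>"
proof -
  interpret \<tau>: nat_trans A B F G \<tau> by fact
  show "horiz_comp A B F \<tau> (id_fctr A) (\<lambda>x \<in> Obj A. Id A (FObj (id_fctr A) x)) = \<tau>"
    "horiz_comp A B (id_fctr B) (\<lambda>x \<in> Obj B. Id B (FObj (id_fctr B) x)) G \<tau> = \<tau>"
    by (auto intro!: extensionalityI [of _ "Obj A"] \<tau>.components_extensional simp: horiz_comp_def)
qed

section \<open>The 2-category of categories\<close>

lemma fctr_cat_simps [simp]:
  "Obj (fctr_cat A B) = {F. cat_functor A B F}"
  "(F, \<tau>, G) \<in> Arr (fctr_cat A B) \<longleftrightarrow> nat_trans A B F G \<tau>"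
  "Dom (fctr_cat A B) (F, \<tau>, G) = F"
  "Cod (fctr_cat A B) (F, \<tau>, G) = G"
  "Id (fctr_cat A B) F = (F, \<lambda>x \<in> Obj A. Id B (FObj F x), F)"
  "Comp (fctr_cat A B) (G', \<sigma>, H) (F, \<tau>, G) = (F, vert_comp A B \<sigma> \<tau>, H)"
  by (auto simp: fctr_cat_def nat_trans_def)

lemma category_fctr_cat: "category (fctr_cat A B)"
  unfolding fctr_cat_def
  by (rule category_hom_presented)
    (auto intro: nat_trans_id nat_trans_vert_comp vert_comp_id vert_comp_assoc)

lemma Cat_simps [simp]:
  "Obj2 Cat = {A. category A}"
  "Hom2 Cat = fctr_cat"
  "Unit2 Cat = id_fctr"
  by (auto simp: Cat_def)

lemma Cat_HComp_simps [simp]: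
  "\<lbrakk>cat_functor A B F; cat_functor B C G\<rbrakk> \<Longrightarrow> FObj (HComp Cat A B C) (G, F) = comp_fctr A G F"
  "\<lbrakk>nat_trans A B F F' \<tau>; nat_trans B C G G' \<sigma>\<rbrakk>
    \<Longrightarrow> FArr (HComp Cat A B C) ((G, \<sigma>, G'), (F, \<tau>, F'))
      = (comp_fctr A G F, horiz_comp A C G \<sigma> F' \<tau>, comp_fctr A G' F')"
  by (auto simp: Cat_def)

lemma Cat_HComp_extensional:
  "FObj (HComp Cat A B C) \<in> extensional ({G. cat_functor B C G} \<times> {F. cat_functor A B F})"
  "FArr (HComp Cat A B C) \<in> extensional (Arr (fctr_cat B C) \<times> Arr (fctr_cat A B))"
  by (auto simp: Cat_def)

lemma cat_functor_Cat_HComp: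
  "cat_functor (prod_cat (fctr_cat B C) (fctr_cat A B)) (fctr_cat A C) (HComp Cat A B C)"
proof (rule cat_functorI, goal_cases)
  case (6 p)
  then obtain G \<sigma> G' F \<tau> F' where p: "p = ((G, \<sigma>, G'), (F, \<tau>, F'))"
    and nat: "nat_trans B C G G' \<sigma>" "nat_trans A B F F' \<tau>"
    by (cases p) auto
  note fctrs = nat [THEN nat_trans.axioms(1)] nat [THEN nat_trans.axioms(2)]
  show ?case
    using nat fctrs by (simp add: p nat_trans_horiz_comp)
next
  case (8 p q)
  then show ?case
    by (cases p; cases q) (auto simp: nat_trans_horiz_comp nat_trans_vert_comp interchange)
qed (auto simp: category_prod_cat category_fctr_cat Cat_HComp_extensional cat_functor_comp
  nat_trans_id horiz_comp_id_id)

lemma two_category_Cat: "two_category Cat"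
proof (rule two_category.intro, goal_cases)
  case (4 A B C D F G H)
  then show ?case
    by (simp add: cat_functor_comp comp_fctr_assoc)
next
  case (5 A B C D \<alpha> \<beta> \<gamma>)
  then obtain F \<tau> F' G \<sigma> G' H \<rho> H' where cells: "\<alpha> = (F, \<tau>, F')" "\<beta> = (G, \<sigma>, G')" "\<gamma> = (H, \<rho>, H')"
    and nat: "nat_trans A B F F' \<tau>" "nat_trans B C G G' \<sigma>" "nat_trans C D H H' \<rho>"
    by (cases \<alpha>; cases \<beta>; cases \<gamma>) auto
  note fctrs = nat [THEN nat_trans.axioms(1)] nat [THEN nat_trans.axioms(2)]
  show ?case
    using nat fctrs by (simp add: cells nat_trans_horiz_comp comp_fctr_assoc horiz_comp_assoc)
next
  case (7 A B \<alpha>)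
  then obtain F \<tau> F' where cell: "\<alpha> = (F, \<tau>, F')" and nat: "nat_trans A B F F' \<tau>"
    by (cases \<alpha>) auto
  then show ?case
    using 7 nat [THEN nat_trans.axioms(1)] nat [THEN nat_trans.axioms(2)]
    by (simp add: nat_trans_id cat_functor_id comp_fctr_id horiz_comp_unit)
next
  case (9 A B \<alpha>)
  then obtain F \<tau> F' where cell: "\<alpha> = (F, \<tau>, F')" and nat: "nat_trans A B F F' \<tau>"
    by (cases \<alpha>) auto
  then show ?case
    using 9 nat [THEN nat_trans.axioms(1)] nat [THEN nat_trans.axioms(2)]
    by (simp add: nat_trans_id cat_functor_id comp_fctr_id horiz_comp_unit)
qed (auto simp: category_fctr_cat cat_functor_id cat_functor_Cat_HComp comp_fctr_id)

section \<open>Oplax morphisms and their 2-cells\<close>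

locale parametrized_endofunctor =
  A: category A + X: category X + F: cat_functor "prod_cat A X" X F
  for A :: "('oa, 'aa) cat" and X :: "('ox, 'ax) cat" and F
begin

lemma action_id [simp]:
  "\<lbrakk>a \<in> Obj A; x \<in> Obj X\<rbrakk> \<Longrightarrow> FArr F (Id A a, Id X x) = Id X (FObj F (a, x))"
  using F.id [of "(a, x)"] by simp

lemma action_comp [simp]:
  assumes "f \<in> Arr A" "f' \<in> Arr A" "Dom A f' = Cod A f"
    and "g \<in> Arr X" "g' \<in> Arr X" "Dom X g' = Cod X g"
  shows "FArr F (Comp A f' f, Comp X g' g) = Comp X (FArr F (f', g')) (FArr F (f, g))"
  using F.comp [of "(f, g)" "(f', g')"] assms by simp

end

lemma in_param_endos_iff [simp]:
  "(A, X, F) \<in> param_endos \<longleftrightarrow> parametrized_endofunctor A X F"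
  by (auto simp: param_endos_def parametrized_endofunctor_def)

text \<open>The typing of \<open>\<delta>\<close> by the composite functors \<open>G \<circ> (U \<times> V)\<close> and \<open>V \<circ> F\<close> is that of the
  2-category; the rules on pairs \<open>(a, x)\<close> unfold these composites.\<close>

locale oplax_morphism =
  K: parametrized_endofunctor A X F + L: parametrized_endofunctor B Y G +
  U: cat_functor A B U + V: cat_functor X Y V +
  \<delta>: nat_trans "prod_cat A X" Y "comp_fctr (prod_cat A X) G (prod_fctr A X U V)"
    "comp_fctr (prod_cat A X) V F" \<delta>
  for A :: "('oa, 'aa) cat" and X :: "('ox, 'ax) cat" and F
    and B :: "('oa, 'aa) cat" and Y :: "('ox, 'ax) cat" and G and U V \<delta>
begin

lemma square:
  assumes "f \<in> Arr A" "Dom A f = a" "Cod A f = b" "g \<in> Arr X" "Dom X g = x" "Cod X g = y"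
  shows "Comp Y (\<delta> (b, y)) (FArr G (FArr U f, FArr V g))
    = Comp Y (FArr V (FArr F (f, g))) (\<delta> (a, x))"
  using \<delta>.square [of "(f, g)" "(a, x)" "(b, y)"] assms by simp

end

lemma is_oplax_iff:
  assumes "parametrized_endofunctor A X F" "parametrized_endofunctor B Y G"
  shows "is_oplax (A, X, F) (B, Y, G) (U, V, \<delta>) \<longleftrightarrow> oplax_morphism A X F B Y G U V \<delta>"
  using assms by (auto simp: oplax_morphism_def)

lemma oplax_morphismI:
  assumes "parametrized_endofunctor A X F" "parametrized_endofunctor B Y G"
    and "cat_functor A B U" "cat_functor X Y V"
    and "\<delta> \<in> extensional (Obj A \<times> Obj X)"
    and "\<And>a x. \<lbrakk>a \<in> Obj A; x \<in> Obj X\<rbrakk> \<Longrightarrow> \<delta> (a, x) \<in> Arr Y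
      \<and> Dom Y (\<delta> (a, x)) = FObj G (FObj U a, FObj V x) \<and> Cod Y (\<delta> (a, x)) = FObj V (FObj F (a, x))"
    and "\<And>f g. \<lbrakk>f \<in> Arr A; g \<in> Arr X\<rbrakk>
      \<Longrightarrow> Comp Y (\<delta> (Cod A f, Cod X g)) (FArr G (FArr U f, FArr V g))
        = Comp Y (FArr V (FArr F (f, g))) (\<delta> (Dom A f, Dom X g))"
  shows "oplax_morphism A X F B Y G U V \<delta>"
proof -
  interpret K: parametrized_endofunctor A X F by fact
  interpret L: parametrized_endofunctor B Y G by fact
  interpret U: cat_functor A B U by fact
  interpret V: cat_functor X Y V by fact
  have "nat_trans (prod_cat A X) Y (comp_fctr (prod_cat A X) G (prod_fctr A X U V))
    (comp_fctr (prod_cat A X) V F) \<delta>"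
  proof (rule nat_transI)
    show "cat_functor (prod_cat A X) Y (comp_fctr (prod_cat A X) G (prod_fctr A X U V))"
      "cat_functor (prod_cat A X) Y (comp_fctr (prod_cat A X) V F)"
      using assms(3,4) K.F.cat_functor_axioms L.F.cat_functor_axioms
      by (blast intro: cat_functor_comp cat_functor_prod)+
  qed (use assms(5-) in \<open>auto\<close>)
  then show ?thesis
    using assms by (simp add: oplax_morphism_def)
qed

lemma oplax_morphism_id:
  assumes "parametrized_endofunctor A X F"
  shows "oplax_morphism A X F A X F (id_fctr A) (id_fctr X)
    (\<lambda>(a, x) \<in> Obj A \<times> Obj X. Id X (FObj F (a, x)))"
proof -
  interpret K: parametrized_endofunctor A X F by fact
  show ?thesis
    by (rule oplax_morphismI)
      (auto simp: assms cat_functor_id K.A.category_axioms K.X.category_axioms)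
qed

text \<open>The pasted transformation is \<open>Q \<delta> \<circ> \<epsilon> (U \<times> V)\<close>. Its naturality square consists of the
  square of \<open>\<epsilon>\<close> at \<open>(U f, V g)\<close> followed by the image under \<open>Q\<close> of the square of \<open>\<delta>\<close> at \<open>(f, g)\<close>.\<close>

lemma oplax_morphism_comp:
  assumes "oplax_morphism A X F B Y G U V \<delta>" "oplax_morphism B Y G C Z H P Q \<epsilon>"
  shows "oplax_morphism A X F C Z H (comp_fctr A P U) (comp_fctr X Q V)
    (\<lambda>(a, x) \<in> Obj A \<times> Obj X. Comp Z (FArr Q (\<delta> (a, x))) (\<epsilon> (FObj U a, FObj V x)))"
proof -
  interpret M: oplax_morphism A X F B Y G U V \<delta> by fact
  interpret N: oplax_morphism B Y G C Z H P Q \<epsilon> by fact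
  have square: "Comp Z (FArr Q (\<delta> (Cod A f, Cod X g)))
      (Comp Z (FArr Q (FArr G (FArr U f, FArr V g))) (\<epsilon> (FObj U (Dom A f), FObj V (Dom X g))))
    = Comp Z (FArr Q (FArr V (FArr F (f, g))))
      (Comp Z (FArr Q (\<delta> (Dom A f, Dom X g))) (\<epsilon> (FObj U (Dom A f), FObj V (Dom X g))))"
    (is "Comp Z ?d (Comp Z ?g ?e) = Comp Z ?f (Comp Z ?d' ?e)")
    if fg: "f \<in> Arr A" "g \<in> Arr X" for f g
  proof -
    have "Comp Z ?d ?g = FArr Q (Comp Y (\<delta> (Cod A f, Cod X g)) (FArr G (FArr U f, FArr V g)))"
      using fg by simp
    also have "\<dots> = Comp Z ?f ?d'"
      using fg by (simp add: M.square)
    finally have "Comp Z (Comp Z ?d ?g) ?e = Comp Z (Comp Z ?f ?d') ?e"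
      by simp
    then show ?thesis
      using fg by simp
  qed
  show ?thesis
  proof (rule oplax_morphismI)
    show "cat_functor A C (comp_fctr A P U)" "cat_functor X Z (comp_fctr X Q V)"
      by (blast intro: cat_functor_comp M.U.cat_functor_axioms M.V.cat_functor_axioms
          N.U.cat_functor_axioms N.V.cat_functor_axioms)+
  qed (auto simp: M.K.parametrized_endofunctor_axioms N.L.parametrized_endofunctor_axioms N.square square)
qed

lemma oplax_comp_id:
  assumes "oplax_morphism A X F B Y G U V \<delta>"
  shows "oplax_comp (A, X, F) (B, Y, G) (U, V, \<delta>) (oplax_id (A, X, F)) = (U, V, \<delta>)"
    "oplax_comp (A, X, F) (B, Y, G) (oplax_id (B, Y, G)) (U, V, \<delta>) = (U, V, \<delta>)"
proof -
  interpret M: oplax_morphism A X F B Y G U V \<delta> by fact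
  have "\<delta> \<in> extensional (Obj A \<times> Obj X)"
    using M.\<delta>.components_extensional by simp
  then show "oplax_comp (A, X, F) (B, Y, G) (U, V, \<delta>) (oplax_id (A, X, F)) = (U, V, \<delta>)"
    "oplax_comp (A, X, F) (B, Y, G) (oplax_id (B, Y, G)) (U, V, \<delta>) = (U, V, \<delta>)"
    by (auto simp: comp_fctr_id [OF M.U.cat_functor_axioms] comp_fctr_id [OF M.V.cat_functor_axioms]
        intro!: extensionalityI [of _ "Obj A \<times> Obj X"])
qed

text \<open>Either bracketing pastes to \<open>S Q \<delta> \<circ> S \<epsilon> \<circ> \<zeta>\<close> at the appropriate objects, by functoriality
  of \<open>S\<close> and associativity in the last category.\<close>

lemma oplax_comp_assoc:
  assumes "oplax_morphism A X F B Y G U V \<delta>" "oplax_morphism B Y G C Z H P Q \<epsilon>"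
    and "oplax_morphism C Z H D W J R S \<zeta>"
  shows "oplax_comp (A, X, F) (D, W, J) (R, S, \<zeta>) (oplax_comp (A, X, F) (C, Z, H) (P, Q, \<epsilon>) (U, V, \<delta>))
    = oplax_comp (A, X, F) (D, W, J)
      (oplax_comp (B, Y, G) (D, W, J) (R, S, \<zeta>) (P, Q, \<epsilon>)) (U, V, \<delta>)"
proof -
  interpret M: oplax_morphism A X F B Y G U V \<delta> by fact
  interpret N: oplax_morphism B Y G C Z H P Q \<epsilon> by fact
  interpret O: oplax_morphism C Z H D W J R S \<zeta> by fact
  show ?thesis
    by (auto simp: fun_eq_iff comp_fctr_assoc [OF M.U.cat_functor_axioms N.U.cat_functor_axioms
          O.U.cat_functor_axioms]
        comp_fctr_assoc [OF M.V.cat_functor_axioms N.V.cat_functor_axioms O.V.cat_functor_axioms]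
        restrict_def)
qed

locale oplax_cell =
  M: oplax_morphism A X F B Y G U V \<delta> + M': oplax_morphism A X F B Y G U' V' \<delta>' +
  \<omega>: nat_trans A B U U' \<omega> + \<nu>: nat_trans X Y V V' \<nu>
  for A :: "('oa, 'aa) cat" and X :: "('ox, 'ax) cat" and F
    and B :: "('oa, 'aa) cat" and Y :: "('ox, 'ax) cat" and G and U V \<delta> U' V' \<delta>' \<omega> \<nu> +
  assumes compatible: "\<lbrakk>a \<in> Obj A; x \<in> Obj X\<rbrakk>
    \<Longrightarrow> Comp Y (\<nu> (FObj F (a, x))) (\<delta> (a, x)) = Comp Y (\<delta>' (a, x)) (FArr G (\<omega> a, \<nu> x))"
begin

lemma compatible_comp:
  assumes "a \<in> Obj A" "x \<in> Obj X" "h \<in> Arr Y" "Cod Y h = FObj G (FObj U a, FObj V x)"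
  shows "Comp Y (\<nu> (FObj F (a, x))) (Comp Y (\<delta> (a, x)) h)
    = Comp Y (\<delta>' (a, x)) (Comp Y (FArr G (\<omega> a, \<nu> x)) h)"
proof -
  have "Comp Y (Comp Y (\<nu> (FObj F (a, x))) (\<delta> (a, x))) h
    = Comp Y (Comp Y (\<delta>' (a, x)) (FArr G (\<omega> a, \<nu> x))) h"
    using assms by (simp only: compatible)
  then show ?thesis
    using assms by simp
qed

end

lemma is_oplax_2cell_iff:
  assumes "oplax_morphism A X F B Y G U V \<delta>" "oplax_morphism A X F B Y G U' V' \<delta>'"
  shows "is_oplax_2cell (A, X, F) (B, Y, G) (U, V, \<delta>) (\<omega>, \<nu>) (U', V', \<delta>')
    \<longleftrightarrow> oplax_cell A X F B Y G U V \<delta> U' V' \<delta>' \<omega> \<nu>"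
  using assms by (auto simp: oplax_cell_def oplax_cell_axioms_def)

lemma oplax_cell_id:
  assumes "oplax_morphism A X F B Y G U V \<delta>"
  shows "oplax_cell A X F B Y G U V \<delta> U V \<delta>
    (\<lambda>a \<in> Obj A. Id B (FObj U a)) (\<lambda>x \<in> Obj X. Id Y (FObj V x))"
proof -
  interpret M: oplax_morphism A X F B Y G U V \<delta> by fact
  show ?thesis
    by (intro oplax_cell.intro oplax_cell_axioms.intro assms nat_trans_id
        M.U.cat_functor_axioms M.V.cat_functor_axioms) simp
qed

text \<open>The two compatibility squares are stacked:
  \<open>\<nu>' \<nu> \<delta> = \<nu>' \<delta>' G(\<omega>, \<nu>) = \<delta>'' G(\<omega>', \<nu>') G(\<omega>, \<nu>)\<close>.\<close>

lemma oplax_cell_vert_comp: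
  assumes "oplax_cell A X F B Y G U V \<delta> U' V' \<delta>' \<omega> \<nu>"
    and "oplax_cell A X F B Y G U' V' \<delta>' U'' V'' \<delta>'' \<omega>' \<nu>'"
  shows "oplax_cell A X F B Y G U V \<delta> U'' V'' \<delta>'' (vert_comp A B \<omega>' \<omega>) (vert_comp X Y \<nu>' \<nu>)"
proof -
  interpret \<alpha>: oplax_cell A X F B Y G U V \<delta> U' V' \<delta>' \<omega> \<nu> by fact
  interpret \<beta>: oplax_cell A X F B Y G U' V' \<delta>' U'' V'' \<delta>'' \<omega>' \<nu>' by fact
  show ?thesis
    by (intro oplax_cell.intro oplax_cell_axioms.intro \<alpha>.M.oplax_morphism_axioms
        \<beta>.M'.oplax_morphism_axioms nat_trans_vert_comp [OF \<alpha>.\<omega>.nat_trans_axioms \<beta>.\<omega>.nat_trans_axioms]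
        nat_trans_vert_comp [OF \<alpha>.\<nu>.nat_trans_axioms \<beta>.\<nu>.nat_trans_axioms])
      (simp add: \<alpha>.compatible \<beta>.compatible_comp)
qed

text \<open>With \<open>\<psi> P \<omega>\<close> and \<open>\<chi> Q \<nu>\<close> as the two components, compatibility is the chain
  \<open>\<chi> Q\<nu> Q\<delta> \<epsilon> = \<chi> Q\<delta>' QG(\<omega>, \<nu>) \<epsilon> = \<chi> Q\<delta>' \<epsilon> H(P\<omega>, Q\<nu>) = Q'\<delta>' \<chi> \<epsilon> H(P\<omega>, Q\<nu>) =
  Q'\<delta>' \<epsilon>' H(\<psi>, \<chi>) H(P\<omega>, Q\<nu>)\<close>, which uses in turn the image under \<open>Q\<close> of the compatibility of
  \<open>(\<omega>, \<nu>)\<close>, naturality of \<open>\<epsilon>\<close> at \<open>(\<omega>, \<nu>)\<close>, naturality of \<open>\<chi>\<close> at \<open>\<delta>'\<close>, and the compatibility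
  of \<open>(\<psi>, \<chi>)\<close>.\<close>

lemma oplax_cell_horiz_comp:
  assumes "oplax_cell A X F B Y G U V \<delta> U' V' \<delta>' \<omega> \<nu>"
    and "oplax_cell B Y G C Z H P Q \<epsilon> P' Q' \<epsilon>' \<psi> \<chi>"
  shows "oplax_cell A X F C Z H
    (comp_fctr A P U) (comp_fctr X Q V)
    (\<lambda>(a, x) \<in> Obj A \<times> Obj X. Comp Z (FArr Q (\<delta> (a, x))) (\<epsilon> (FObj U a, FObj V x)))
    (comp_fctr A P' U') (comp_fctr X Q' V')
    (\<lambda>(a, x) \<in> Obj A \<times> Obj X. Comp Z (FArr Q' (\<delta>' (a, x))) (\<epsilon>' (FObj U' a, FObj V' x)))
    (horiz_comp A C P \<psi> U' \<omega>) (horiz_comp X Z Q \<chi> V' \<nu>)"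
proof -
  interpret \<alpha>: oplax_cell A X F B Y G U V \<delta> U' V' \<delta>' \<omega> \<nu> by fact
  interpret \<beta>: oplax_cell B Y G C Z H P Q \<epsilon> P' Q' \<epsilon>' \<psi> \<chi> by fact
  have "Comp Z (\<chi> (FObj V' (FObj F (a, x)))) (Comp Z (FArr Q (\<nu> (FObj F (a, x))))
      (Comp Z (FArr Q (\<delta> (a, x))) (\<epsilon> (FObj U a, FObj V x))))
    = Comp Z (FArr Q' (\<delta>' (a, x))) (Comp Z (\<epsilon>' (FObj U' a, FObj V' x))
        (Comp Z (FArr H (\<psi> (FObj U' a), \<chi> (FObj V' x))) (FArr H (FArr P (\<omega> a), FArr Q (\<nu> x)))))"
    (is "Comp Z ?c (Comp Z ?n (Comp Z ?d ?e)) = Comp Z ?d' (Comp Z ?e' (Comp Z ?h ?k))")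
    if ax: "a \<in> Obj A" "x \<in> Obj X" for a x
  proof -
    have "Comp Z ?n ?d = FArr Q (Comp Y (\<nu> (FObj F (a, x))) (\<delta> (a, x)))"
      using ax by simp
    also have "\<dots> = Comp Z (FArr Q (\<delta>' (a, x))) (FArr Q (FArr G (\<omega> a, \<nu> x)))"
      using ax by (simp add: \<alpha>.compatible)
    finally have "Comp Z (Comp Z ?n ?d) ?e
      = Comp Z (Comp Z (FArr Q (\<delta>' (a, x))) (FArr Q (FArr G (\<omega> a, \<nu> x)))) ?e"
      by simp
    then have "Comp Z ?n (Comp Z ?d ?e)
      = Comp Z (FArr Q (\<delta>' (a, x))) (Comp Z (FArr Q (FArr G (\<omega> a, \<nu> x))) ?e)"
      using ax by simp
    also have "Comp Z (FArr Q (FArr G (\<omega> a, \<nu> x))) ?e = Comp Z (\<epsilon> (FObj U' a, FObj V' x)) ?k"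
      using ax by (simp add: \<beta>.M.square)
    finally have "Comp Z ?c (Comp Z ?n (Comp Z ?d ?e))
      = Comp Z ?c (Comp Z (FArr Q (\<delta>' (a, x))) (Comp Z (\<epsilon> (FObj U' a, FObj V' x)) ?k))"
      by simp
    also have "\<dots> = Comp Z ?d' (Comp Z (\<chi> (FObj G (FObj U' a, FObj V' x)))
        (Comp Z (\<epsilon> (FObj U' a, FObj V' x)) ?k))"
      using ax by (simp add: \<beta>.\<nu>.square_comp)
    also have "\<dots> = Comp Z ?d' (Comp Z ?e' (Comp Z ?h ?k))"
      using ax by (simp add: \<beta>.compatible_comp)
    finally show ?thesis .
  qed
  then show ?thesis
    by (intro oplax_cell.intro oplax_cell_axioms.intro
        oplax_morphism_comp [OF \<alpha>.M.oplax_morphism_axioms \<beta>.M.oplax_morphism_axioms]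
        oplax_morphism_comp [OF \<alpha>.M'.oplax_morphism_axioms \<beta>.M'.oplax_morphism_axioms]
        nat_trans_horiz_comp [OF \<alpha>.\<omega>.nat_trans_axioms \<beta>.\<omega>.nat_trans_axioms]
        nat_trans_horiz_comp [OF \<alpha>.\<nu>.nat_trans_axioms \<beta>.\<nu>.nat_trans_axioms]) simp
qed

section \<open>The 2-category of parametrized endofunctors\<close>

lemma oplax_hom_simps:
  assumes "parametrized_endofunctor A X F" "parametrized_endofunctor B Y G"
  shows "(U, V, \<delta>) \<in> Obj (oplax_hom (A, X, F) (B, Y, G)) \<longleftrightarrow> oplax_morphism A X F B Y G U V \<delta>"
    "((U, V, \<delta>), (\<omega>, \<nu>), (U', V', \<delta>')) \<in> Arr (oplax_hom (A, X, F) (B, Y, G))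
      \<longleftrightarrow> oplax_cell A X F B Y G U V \<delta> U' V' \<delta>' \<omega> \<nu>"
    "Dom (oplax_hom (A, X, F) (B, Y, G)) (M, p, M') = M"
    "Cod (oplax_hom (A, X, F) (B, Y, G)) (M, p, M') = M'"
    "Id (oplax_hom (A, X, F) (B, Y, G)) (U, V, \<delta>)
      = ((U, V, \<delta>), (\<lambda>a \<in> Obj A. Id B (FObj U a), \<lambda>x \<in> Obj X. Id Y (FObj V x)), (U, V, \<delta>))"
    "Comp (oplax_hom (A, X, F) (B, Y, G)) (N, (\<omega>', \<nu>'), N') (M, (\<omega>, \<nu>), M')
      = (M, (vert_comp A B \<omega>' \<omega>, vert_comp X Y \<nu>' \<nu>), N')"
proof -
  show "((U, V, \<delta>), (\<omega>, \<nu>), (U', V', \<delta>')) \<in> Arr (oplax_hom (A, X, F) (B, Y, G))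
      \<longleftrightarrow> oplax_cell A X F B Y G U V \<delta> U' V' \<delta>' \<omega> \<nu>"
    using assms by (auto simp: is_oplax_iff is_oplax_2cell_iff oplax_cell_def
        simp del: is_oplax.simps is_oplax_2cell.simps)
qed (use assms in \<open>auto simp: is_oplax_iff simp del: is_oplax.simps\<close>)

text \<open>From here on 1-cells and 2-cells are handled through the locales; the defining equations
  would break up composites to which the lemmas above apply.\<close>

declare oplax_hom.simps [simp del] oplax_id.simps [simp del] oplax_comp.simps [simp del]
  oplax_hcomp_2cell.simps [simp del]

lemma category_oplax_hom:
  assumes "parametrized_endofunctor A X F" "parametrized_endofunctor B Y G"
  shows "category (oplax_hom (A, X, F) (B, Y, G))"
  unfolding oplax_hom.simps
proof (rule category_hom_presented, goal_cases)
  case (1 M)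
  then show ?case
    by (cases M) (simp add: is_oplax_iff is_oplax_2cell_iff oplax_cell_id assms
        del: is_oplax.simps is_oplax_2cell.simps)
next
  case (2 M N M' p q)
  then show ?case
    by (cases M; cases N; cases M'; cases p; cases q)
      (simp add: is_oplax_iff is_oplax_2cell_iff assms oplax_cell_vert_comp
        del: is_oplax.simps is_oplax_2cell.simps)
next
  case (3 M N p)
  then show ?case
    by (cases M; cases N; cases p) (auto simp: vert_comp_id)
next
  case (4 M N p)
  then show ?case
    by (cases M; cases N; cases p) (auto simp: vert_comp_id)
next
  case (5 L M N M' p q r)
  then show ?case
    by (cases L; cases M; cases N; cases M'; cases p; cases q; cases r)
      (auto intro: vert_comp_assoc)
qed

lemma oplax_hom_ObjE:
  assumes "M \<in> Obj (oplax_hom (A, X, F) (B, Y, G))"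
    and "parametrized_endofunctor A X F" "parametrized_endofunctor B Y G"
  obtains U V \<delta> where "M = (U, V, \<delta>)" "oplax_morphism A X F B Y G U V \<delta>"
  using assms oplax_hom_simps(1) by (cases M) blast

lemma oplax_hom_ArrE:
  assumes "\<alpha> \<in> Arr (oplax_hom (A, X, F) (B, Y, G))"
    and "parametrized_endofunctor A X F" "parametrized_endofunctor B Y G"
  obtains U V \<delta> \<omega> \<nu> U' V' \<delta>' where "\<alpha> = ((U, V, \<delta>), (\<omega>, \<nu>), (U', V', \<delta>'))"
    "oplax_cell A X F B Y G U V \<delta> U' V' \<delta>' \<omega> \<nu>"
  using assms(1) oplax_hom_simps(2) [OF assms(2,3)] by (cases \<alpha>) auto

lemma oplax_id_Obj:
  assumes "parametrized_endofunctor A X F"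
  shows "oplax_id (A, X, F) \<in> Obj (oplax_hom (A, X, F) (A, X, F))"
  using assms by (simp add: oplax_id.simps oplax_hom_simps oplax_morphism_id)

lemma oplax_comp_Obj:
  assumes "oplax_morphism A X F B Y G U V \<delta>" "oplax_morphism B Y G C Z H P Q \<epsilon>"
  shows "oplax_comp (A, X, F) (C, Z, H) (P, Q, \<epsilon>) (U, V, \<delta>) \<in> Obj (oplax_hom (A, X, F) (C, Z, H))"
  using assms oplax_morphism_comp [OF assms]
  by (auto simp: oplax_comp.simps oplax_hom_simps oplax_morphism_def)

lemma oplax_hcomp_2cell_Arr:
  assumes "oplax_cell A X F B Y G U V \<delta> U' V' \<delta>' \<omega> \<nu>"
    and "oplax_cell B Y G C Z H P Q \<epsilon> P' Q' \<epsilon>' \<psi> \<chi>"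
  shows "oplax_hcomp_2cell (A, X, F) (C, Z, H)
      ((P, Q, \<epsilon>), (\<psi>, \<chi>), (P', Q', \<epsilon>')) ((U, V, \<delta>), (\<omega>, \<nu>), (U', V', \<delta>'))
    \<in> Arr (oplax_hom (A, X, F) (C, Z, H))"
proof -
  interpret \<alpha>: oplax_cell A X F B Y G U V \<delta> U' V' \<delta>' \<omega> \<nu> by fact
  interpret \<beta>: oplax_cell B Y G C Z H P Q \<epsilon> P' Q' \<epsilon>' \<psi> \<chi> by fact
  show ?thesis
    using oplax_cell_horiz_comp [OF assms]
    by (simp add: oplax_hcomp_2cell.simps oplax_comp.simps oplax_hom_simps
        \<alpha>.M.K.parametrized_endofunctor_axioms \<beta>.M.L.parametrized_endofunctor_axioms)
qed

lemma CatCat_simps [simp]: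
  "Obj2 CatCat = param_endos"
  "Hom2 CatCat = oplax_hom"
  "Unit2 CatCat = oplax_id"
  by (auto simp: CatCat_def)

lemma CatCat_HComp_simps [simp]:
  "\<lbrakk>M \<in> Obj (oplax_hom k l); N \<in> Obj (oplax_hom l m)\<rbrakk>
    \<Longrightarrow> FObj (HComp CatCat k l m) (N, M) = oplax_comp k m N M"
  "\<lbrakk>\<alpha> \<in> Arr (oplax_hom k l); \<beta> \<in> Arr (oplax_hom l m)\<rbrakk>
    \<Longrightarrow> FArr (HComp CatCat k l m) (\<beta>, \<alpha>) = oplax_hcomp_2cell k m \<beta> \<alpha>"
  by (auto simp: CatCat_def)

lemma CatCat_HComp_extensional:
  "FObj (HComp CatCat k l m) \<in> extensional (Obj (oplax_hom l m) \<times> Obj (oplax_hom k l))"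
  "FArr (HComp CatCat k l m) \<in> extensional (Arr (oplax_hom l m) \<times> Arr (oplax_hom k l))"
  by (auto simp: CatCat_def)

text \<open>A 2-cell is determined by its endpoints and a pair of natural transformations, and all
  operations on 2-cells act on the two transformations separately. Composites are therefore preserved
  by the interchange law for natural transformations, applied once in each coordinate.\<close>

lemma cat_functor_CatCat_HComp:
  fixes A C :: "('oa, 'aa) cat" and X Z :: "('ox, 'ax) cat"
  assumes pe: "parametrized_endofunctor A X F" "parametrized_endofunctor B Y G"
    "parametrized_endofunctor C Z H"
  shows "cat_functor (prod_cat (oplax_hom (B, Y, G) (C, Z, H)) (oplax_hom (A, X, F) (B, Y, G)))
    (oplax_hom (A, X, F) (C, Z, H)) (HComp CatCat (A, X, F) (B, Y, G) (C, Z, H))"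
proof (rule cat_functorI, goal_cases)
  case (5 p)
  then show ?case
    using pe by (cases p) (auto elim!: oplax_hom_ObjE simp: oplax_comp_Obj)
next
  case (6 p)
  then obtain \<alpha> \<beta> where p: "p = (\<beta>, \<alpha>)" and arr: "\<beta> \<in> Arr (oplax_hom (B, Y, G) (C, Z, H))"
    "\<alpha> \<in> Arr (oplax_hom (A, X, F) (B, Y, G))"
    by (cases p) auto
  obtain U V \<delta> \<omega> \<nu> U' V' \<delta>' where \<alpha>: "\<alpha> = ((U, V, \<delta>), (\<omega>, \<nu>), (U', V', \<delta>'))"
    "oplax_cell A X F B Y G U V \<delta> U' V' \<delta>' \<omega> \<nu>"
    using oplax_hom_ArrE [OF arr(2) pe(1,2)] .
  obtain P Q \<epsilon> \<psi> \<chi> P' Q' \<epsilon>' where \<beta>: "\<beta> = ((P, Q, \<epsilon>), (\<psi>, \<chi>), (P', Q', \<epsilon>'))"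
    "oplax_cell B Y G C Z H P Q \<epsilon> P' Q' \<epsilon>' \<psi> \<chi>"
    using oplax_hom_ArrE [OF arr(1) pe(2,3)] .
  note mor = oplax_cell.axioms(1,2) [OF \<alpha>(2)] oplax_cell.axioms(1,2) [OF \<beta>(2)]
  have "oplax_hcomp_2cell (A, X, F) (C, Z, H) \<beta> \<alpha> \<in> Arr (oplax_hom (A, X, F) (C, Z, H))"
    using oplax_hcomp_2cell_Arr [OF \<alpha>(2) \<beta>(2)] by (simp add: \<alpha>(1) \<beta>(1))
  moreover have "(U, V, \<delta>) \<in> Obj (oplax_hom (A, X, F) (B, Y, G))"
    "(U', V', \<delta>') \<in> Obj (oplax_hom (A, X, F) (B, Y, G))"
    "(P, Q, \<epsilon>) \<in> Obj (oplax_hom (B, Y, G) (C, Z, H))"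
    "(P', Q', \<epsilon>') \<in> Obj (oplax_hom (B, Y, G) (C, Z, H))"
    using mor pe by (simp_all add: oplax_hom_simps)
  ultimately show ?case
    using arr pe by (simp add: p \<alpha>(1) \<beta>(1) oplax_hom_simps(3-) oplax_hcomp_2cell.simps)
next
  case (7 p)
  then obtain U V \<delta> P Q \<epsilon> where p: "p = ((P, Q, \<epsilon>), (U, V, \<delta>))"
    and mor: "oplax_morphism A X F B Y G U V \<delta>" "oplax_morphism B Y G C Z H P Q \<epsilon>"
    using pe by (cases p) (auto elim!: oplax_hom_ObjE)
  interpret M: oplax_morphism A X F B Y G U V \<delta> by fact
  interpret N: oplax_morphism B Y G C Z H P Q \<epsilon> by fact
  show ?case
    using pe mor
    by (simp add: p oplax_hom_simps oplax_cell_id oplax_hcomp_2cell.simps oplax_comp.simps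
        horiz_comp_id_id [OF M.U.cat_functor_axioms N.U.cat_functor_axioms]
        horiz_comp_id_id [OF M.V.cat_functor_axioms N.V.cat_functor_axioms])
next
  case (8 p q)
  then obtain \<alpha> \<beta> \<alpha>' \<beta>' where pq: "p = (\<beta>, \<alpha>)" "q = (\<beta>', \<alpha>')"
    and arr: "\<beta> \<in> Arr (oplax_hom (B, Y, G) (C, Z, H))" "\<beta>' \<in> Arr (oplax_hom (B, Y, G) (C, Z, H))"
      "\<alpha> \<in> Arr (oplax_hom (A, X, F) (B, Y, G))" "\<alpha>' \<in> Arr (oplax_hom (A, X, F) (B, Y, G))"
    by (cases p; cases q) auto
  obtain U V \<delta> \<omega> \<nu> U' V' \<delta>' where \<alpha>: "\<alpha> = ((U, V, \<delta>), (\<omega>, \<nu>), (U', V', \<delta>'))"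
    "oplax_cell A X F B Y G U V \<delta> U' V' \<delta>' \<omega> \<nu>"
    using oplax_hom_ArrE [OF arr(3) pe(1,2)] .
  obtain W W' \<eta> \<omega>' \<nu>' U'' V'' \<delta>'' where \<alpha>': "\<alpha>' = ((W, W', \<eta>), (\<omega>', \<nu>'), (U'', V'', \<delta>''))"
    "oplax_cell A X F B Y G W W' \<eta> U'' V'' \<delta>'' \<omega>' \<nu>'"
    using oplax_hom_ArrE [OF arr(4) pe(1,2)] .
  obtain P Q \<epsilon> \<psi> \<chi> P' Q' \<epsilon>' where \<beta>: "\<beta> = ((P, Q, \<epsilon>), (\<psi>, \<chi>), (P', Q', \<epsilon>'))"
    "oplax_cell B Y G C Z H P Q \<epsilon> P' Q' \<epsilon>' \<psi> \<chi>"
    using oplax_hom_ArrE [OF arr(1) pe(2,3)] .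
  obtain R R' \<theta> \<psi>' \<chi>' P'' Q'' \<epsilon>'' where \<beta>': "\<beta>' = ((R, R', \<theta>), (\<psi>', \<chi>'), (P'', Q'', \<epsilon>''))"
    "oplax_cell B Y G C Z H R R' \<theta> P'' Q'' \<epsilon>'' \<psi>' \<chi>'"
    using oplax_hom_ArrE [OF arr(2) pe(2,3)] .
  \<comment> \<open>Composability: \<open>\<alpha>'\<close> and \<open>\<beta>'\<close> start at the 1-cells where \<open>\<alpha>\<close> and \<open>\<beta>\<close> end.\<close>
  have [simp]: "W = U'" "W' = V'" "\<eta> = \<delta>'" "R = P'" "R' = Q'" "\<theta> = \<epsilon>'"
    using 8(3) pe by (auto simp: pq \<alpha>(1) \<alpha>'(1) \<beta>(1) \<beta>'(1) oplax_hom_simps)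
  interpret \<alpha>: oplax_cell A X F B Y G U V \<delta> U' V' \<delta>' \<omega> \<nu> by fact
  interpret \<alpha>': oplax_cell A X F B Y G U' V' \<delta>' U'' V'' \<delta>'' \<omega>' \<nu>' using \<alpha>'(2) by simp
  interpret \<beta>: oplax_cell B Y G C Z H P Q \<epsilon> P' Q' \<epsilon>' \<psi> \<chi> by fact
  interpret \<beta>': oplax_cell B Y G C Z H P' Q' \<epsilon>' P'' Q'' \<epsilon>'' \<psi>' \<chi>' using \<beta>'(2) by simp
  have "oplax_cell A X F B Y G U V \<delta> U'' V'' \<delta>'' (vert_comp A B \<omega>' \<omega>) (vert_comp X Y \<nu>' \<nu>)"
    "oplax_cell B Y G C Z H P Q \<epsilon> P'' Q'' \<epsilon>'' (vert_comp B C \<psi>' \<psi>) (vert_comp Y Z \<chi>' \<chi>)"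
    using oplax_cell_vert_comp \<alpha>.oplax_cell_axioms \<alpha>'.oplax_cell_axioms
      \<beta>.oplax_cell_axioms \<beta>'.oplax_cell_axioms by blast+
  then show ?case
    using pe \<alpha>(2) \<alpha>'(2) \<beta>(2) \<beta>'(2)
    by (simp add: pq \<alpha>(1) \<alpha>'(1) \<beta>(1) \<beta>'(1) oplax_hom_simps oplax_hcomp_2cell.simps
        interchange [OF \<alpha>.\<omega>.nat_trans_axioms \<alpha>'.\<omega>.nat_trans_axioms
          \<beta>.\<omega>.nat_trans_axioms \<beta>'.\<omega>.nat_trans_axioms]
        interchange [OF \<alpha>.\<nu>.nat_trans_axioms \<alpha>'.\<nu>.nat_trans_axioms
          \<beta>.\<nu>.nat_trans_axioms \<beta>'.\<nu>.nat_trans_axioms])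
qed (use pe in \<open>auto simp: category_prod_cat category_oplax_hom CatCat_HComp_extensional\<close>)

lemma oplax_hcomp_2cell_assoc:
  assumes "oplax_cell A X F B Y G U V \<delta> U' V' \<delta>' \<omega> \<nu>"
    and "oplax_cell B Y G C Z H P Q \<epsilon> P' Q' \<epsilon>' \<psi> \<chi>"
    and "oplax_cell C Z H D W J R S \<zeta> R' S' \<zeta>' \<rho> \<sigma>"
  shows "oplax_hcomp_2cell (A, X, F) (D, W, J) ((R, S, \<zeta>), (\<rho>, \<sigma>), (R', S', \<zeta>'))
      (oplax_hcomp_2cell (A, X, F) (C, Z, H) ((P, Q, \<epsilon>), (\<psi>, \<chi>), (P', Q', \<epsilon>'))
        ((U, V, \<delta>), (\<omega>, \<nu>), (U', V', \<delta>')))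
    = oplax_hcomp_2cell (A, X, F) (D, W, J)
      (oplax_hcomp_2cell (B, Y, G) (D, W, J) ((R, S, \<zeta>), (\<rho>, \<sigma>), (R', S', \<zeta>'))
        ((P, Q, \<epsilon>), (\<psi>, \<chi>), (P', Q', \<epsilon>'))) ((U, V, \<delta>), (\<omega>, \<nu>), (U', V', \<delta>'))"
proof -
  interpret \<alpha>: oplax_cell A X F B Y G U V \<delta> U' V' \<delta>' \<omega> \<nu> by fact
  interpret \<beta>: oplax_cell B Y G C Z H P Q \<epsilon> P' Q' \<epsilon>' \<psi> \<chi> by fact
  interpret \<gamma>: oplax_cell C Z H D W J R S \<zeta> R' S' \<zeta>' \<rho> \<sigma> by fact
  show ?thesis
    using oplax_comp_assoc [OF \<alpha>.M.oplax_morphism_axioms \<beta>.M.oplax_morphism_axioms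
        \<gamma>.M.oplax_morphism_axioms]
      oplax_comp_assoc [OF \<alpha>.M'.oplax_morphism_axioms \<beta>.M'.oplax_morphism_axioms
        \<gamma>.M'.oplax_morphism_axioms]
    by (simp add: oplax_hcomp_2cell.simps oplax_comp.simps
        horiz_comp_assoc [OF \<alpha>.\<omega>.nat_trans_axioms \<beta>.\<omega>.nat_trans_axioms \<gamma>.\<omega>.nat_trans_axioms]
        horiz_comp_assoc [OF \<alpha>.\<nu>.nat_trans_axioms \<beta>.\<nu>.nat_trans_axioms \<gamma>.\<nu>.nat_trans_axioms])
qed

lemma oplax_hcomp_2cell_unit:
  assumes "oplax_cell A X F B Y G U V \<delta> U' V' \<delta>' \<omega> \<nu>"
  shows "oplax_hcomp_2cell (A, X, F) (B, Y, G) ((U, V, \<delta>), (\<omega>, \<nu>), (U', V', \<delta>'))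
      (Id (oplax_hom (A, X, F) (A, X, F)) (oplax_id (A, X, F)))
    = ((U, V, \<delta>), (\<omega>, \<nu>), (U', V', \<delta>'))"
    "oplax_hcomp_2cell (A, X, F) (B, Y, G)
      (Id (oplax_hom (B, Y, G) (B, Y, G)) (oplax_id (B, Y, G))) ((U, V, \<delta>), (\<omega>, \<nu>), (U', V', \<delta>'))
    = ((U, V, \<delta>), (\<omega>, \<nu>), (U', V', \<delta>'))"
proof -
  interpret \<alpha>: oplax_cell A X F B Y G U V \<delta> U' V' \<delta>' \<omega> \<nu> by fact
  show "oplax_hcomp_2cell (A, X, F) (B, Y, G) ((U, V, \<delta>), (\<omega>, \<nu>), (U', V', \<delta>'))
      (Id (oplax_hom (A, X, F) (A, X, F)) (oplax_id (A, X, F)))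
    = ((U, V, \<delta>), (\<omega>, \<nu>), (U', V', \<delta>'))"
    "oplax_hcomp_2cell (A, X, F) (B, Y, G)
      (Id (oplax_hom (B, Y, G) (B, Y, G)) (oplax_id (B, Y, G))) ((U, V, \<delta>), (\<omega>, \<nu>), (U', V', \<delta>'))
    = ((U, V, \<delta>), (\<omega>, \<nu>), (U', V', \<delta>'))"
    using oplax_comp_id [OF \<alpha>.M.oplax_morphism_axioms] oplax_comp_id [OF \<alpha>.M'.oplax_morphism_axioms]
    by (simp_all add: oplax_id.simps oplax_hcomp_2cell.simps \<alpha>.M.K.parametrized_endofunctor_axioms
        \<alpha>.M.L.parametrized_endofunctor_axioms oplax_hom_simps
        horiz_comp_unit [OF \<alpha>.\<omega>.nat_trans_axioms] horiz_comp_unit [OF \<alpha>.\<nu>.nat_trans_axioms])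
qed

lemma param_endosE:
  assumes "k \<in> param_endos"
  obtains A X F where "k = (A, X, F)" "parametrized_endofunctor A X F"
  using assms by (cases k) auto

lemma two_category_CatCat: "two_category CatCat"
proof (rule two_category.intro, goal_cases)
  case (4 k l m n M N M')
  then show ?case
    by (auto elim!: param_endosE oplax_hom_ObjE simp: oplax_hom_simps oplax_comp_Obj oplax_comp_assoc)
next
  case (5 k l m n \<alpha> \<beta> \<gamma>)
  then show ?case
    by (auto elim!: param_endosE oplax_hom_ArrE
        simp: oplax_hom_simps oplax_hcomp_2cell_Arr oplax_hcomp_2cell_assoc)
next
  case (6 k l M)
  then show ?case
    by (auto elim!: param_endosE oplax_hom_ObjE simp: oplax_hom_simps oplax_id_Obj oplax_comp_id)
next
  case (7 k l \<alpha>)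
  then show ?case
    by (auto elim!: param_endosE oplax_hom_ArrE simp: oplax_hom_simps(2) oplax_hcomp_2cell_unit
        category.id_arr category_oplax_hom oplax_id_Obj)
next
  case (8 k l M)
  then show ?case
    by (auto elim!: param_endosE oplax_hom_ObjE simp: oplax_hom_simps oplax_id_Obj oplax_comp_id)
next
  case (9 k l \<alpha>)
  then show ?case
    by (auto elim!: param_endosE oplax_hom_ArrE simp: oplax_hom_simps(2) oplax_hcomp_2cell_unit
        category.id_arr category_oplax_hom oplax_id_Obj)
qed (auto elim!: param_endosE simp: category_oplax_hom oplax_id_Obj cat_functor_CatCat_HComp)

section \<open>Total categories of algebras\<close>

lemma total_cat_simps [simp]:
  "(a, x, \<xi>) \<in> Obj (total_cat (A, X, F)) \<longleftrightarrow>
    a \<in> Obj A \<and> x \<in> Obj X \<and> \<xi> \<in> Arr X \<and> Dom X \<xi> = FObj F (a, x) \<and> Cod X \<xi> = x"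
  "((a, x, \<xi>), (f, g), (b, y, \<theta>)) \<in> Arr (total_cat (A, X, F)) \<longleftrightarrow>
    (a, x, \<xi>) \<in> Obj (total_cat (A, X, F)) \<and> (b, y, \<theta>) \<in> Obj (total_cat (A, X, F)) \<and>
    f \<in> Arr A \<and> Dom A f = a \<and> Cod A f = b \<and> g \<in> Arr X \<and> Dom X g = x \<and> Cod X g = y \<and>
    Comp X g \<xi> = Comp X \<theta> (FArr F (f, g))"
  "Dom (total_cat (A, X, F)) (s, p, t) = s"
  "Cod (total_cat (A, X, F)) (s, p, t) = t"
  "Id (total_cat (A, X, F)) (a, x, \<xi>) = ((a, x, \<xi>), (Id A a, Id X x), (a, x, \<xi>))"
  "Comp (total_cat (A, X, F)) (t', (f', g'), u) (s, (f, g), t) = (s, (Comp A f' f, Comp X g' g), u)"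
  by (auto simp: in_hom_iff)

declare total_cat.simps [simp del]

lemma alg_arr_cases:
  fixes \<phi> :: "('oa, 'aa, 'ox, 'ax) alg_arr"
  obtains a x \<xi> f g b y \<theta> where "\<phi> = ((a, x, \<xi>), (f, g), (b, y, \<theta>))"
  by (cases \<phi>) auto

text \<open>Algebra morphisms compose because their squares can be placed side by side:
  \<open>g' g \<xi> = g' \<theta> F(f, g) = \<zeta> F(f', g') F(f, g)\<close>.\<close>

lemma category_total_cat:
  assumes "parametrized_endofunctor A X F"
  shows "category (total_cat (A, X, F))"
proof -
  interpret parametrized_endofunctor A X F by fact
  have assoc: "Comp X (Comp X g' g) \<xi> = Comp X \<zeta> (FArr F (Comp A f' f, Comp X g' g))"
    if "((a, x, \<xi>), (f, g), (b, y, \<theta>)) \<in> Arr (total_cat (A, X, F))"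
      "((b, y, \<theta>), (f', g'), (c, z, \<zeta>)) \<in> Arr (total_cat (A, X, F))"
    for a x \<xi> f g b y \<theta> f' g' c z \<zeta>
  proof -
    have "Comp X (Comp X g' g) \<xi> = Comp X g' (Comp X \<theta> (FArr F (f, g)))"
      using that by simp
    also have "\<dots> = Comp X (Comp X g' \<theta>) (FArr F (f, g))"
      using that by (intro X.comp_assoc_right [symmetric]) simp_all
    also have "\<dots> = Comp X \<zeta> (FArr F (Comp A f' f, Comp X g' g))"
      using that by simp
    finally show ?thesis .
  qed
  show ?thesis
    unfolding total_cat.simps
  proof (rule category_hom_presented, goal_cases)
    case (2 s t u p q)
    obtain a x \<xi> b y \<theta> c z \<zeta> f g f' g' where eqs: "s = (a, x, \<xi>)" "t = (b, y, \<theta>)" "u = (c, z, \<zeta>)"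
      "p = (f, g)" "q = (f', g')"
      by (cases s; cases t; cases u; cases p; cases q) auto
    show ?case
      using 2 assoc [of a x \<xi> f g b y \<theta> f' g' c z \<zeta>] by (simp add: eqs in_hom_iff)
  qed (auto simp: in_hom_iff)
qed

lemma total_fctr_simps [simp]:
  "s \<in> Obj (total_cat k) \<Longrightarrow> FObj (total_fctr k l M) s = total_obj l M s"
  "\<phi> \<in> Arr (total_cat k) \<Longrightarrow> FArr (total_fctr k l M) \<phi> = total_arr l M \<phi>"
  by (auto simp: total_fctr_def)

lemma total_fctr_extensional:
  "FObj (total_fctr k l M) \<in> extensional (Obj (total_cat k))"
  "FArr (total_fctr k l M) \<in> extensional (Arr (total_cat k))"
  by (auto simp: total_fctr_def)

text \<open>That \<open>(U f, V g)\<close> is again an algebra morphism is where naturality of \<open>\<delta>\<close> enters: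
  \<open>Vg V\<xi> \<delta> = V\<theta> VF(f, g) \<delta> = V\<theta> \<delta> G(Uf, Vg)\<close>. Identities and composites are preserved because
  they are formed in the two coordinates, on which \<open>U\<close> and \<open>V\<close> act separately.\<close>

lemma cat_functor_total_fctr:
  assumes "oplax_morphism A X F B Y G U V \<delta>"
  shows "cat_functor (total_cat (A, X, F)) (total_cat (B, Y, G))
    (total_fctr (A, X, F) (B, Y, G) (U, V, \<delta>))"
proof -
  interpret oplax_morphism A X F B Y G U V \<delta> by fact
  interpret S: category "total_cat (A, X, F)"
    by (rule category_total_cat) unfold_locales
  interpret T: category "total_cat (B, Y, G)"
    by (rule category_total_cat) unfold_locales
  have obj: "total_obj (B, Y, G) (U, V, \<delta>) s \<in> Obj (total_cat (B, Y, G))"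
    if "s \<in> Obj (total_cat (A, X, F))" for s
    using that by (cases s) simp
  have alg: "Comp Y (FArr V g) (Comp Y (FArr V \<xi>) (\<delta> (a, x)))
      = Comp Y (Comp Y (FArr V \<theta>) (\<delta> (b, y))) (FArr G (FArr U f, FArr V g))"
    if "((a, x, \<xi>), (f, g), (b, y, \<theta>)) \<in> Arr (total_cat (A, X, F))" for a x \<xi> f g b y \<theta>
  proof -
    have "Comp Y (FArr V g) (FArr V \<xi>) = FArr V (Comp X g \<xi>)"
      using that by (intro V.comp [symmetric]) simp_all
    also have "\<dots> = Comp Y (FArr V \<theta>) (FArr V (FArr F (f, g)))"
      using that by simp
    finally have "Comp Y (Comp Y (FArr V g) (FArr V \<xi>)) (\<delta> (a, x))
      = Comp Y (Comp Y (FArr V \<theta>) (FArr V (FArr F (f, g)))) (\<delta> (a, x))"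
      by simp
    then show ?thesis
      using that by (simp add: square)
  qed
  have arr: "total_arr (B, Y, G) (U, V, \<delta>) \<phi> \<in> Arr (total_cat (B, Y, G))"
    if "\<phi> \<in> Arr (total_cat (A, X, F))" for \<phi>
    using that alg by (cases \<phi> rule: alg_arr_cases) auto
  show ?thesis
  proof (rule cat_functorI, goal_cases)
    case (6 \<phi>)
    then show ?case
      using arr [OF 6] by (cases \<phi> rule: alg_arr_cases) simp_all
  next
    case (7 s)
    then show ?case
      using S.id_arr(1) [OF 7] by (cases s) simp
  next
    case (8 \<phi> \<psi>)
    then show ?case
      using S.comp_arr(1) [OF 8]
      by (cases \<phi> rule: alg_arr_cases, simp, cases \<psi> rule: alg_arr_cases) simp_all
  qed (simp_all add: total_fctr_extensional obj S.category_axioms T.category_axioms)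
qed

text \<open>The component \<open>(\<omega>, \<nu>)\<close> is an algebra morphism because
  \<open>\<nu> V\<xi> \<delta> = V'\<xi> \<nu> \<delta> = V'\<xi> \<delta>' G(\<omega>, \<nu>)\<close>, by naturality of \<open>\<nu>\<close> at the structure map \<open>\<xi>\<close> and then by
  compatibility. Naturality in the algebra is naturality of \<open>\<omega>\<close> and of \<open>\<nu>\<close>.\<close>

lemma nat_trans_total:
  assumes "oplax_cell A X F B Y G U V \<delta> U' V' \<delta>' \<omega> \<nu>"
  shows "total_ntrans (A, X, F) (B, Y, G) ((U, V, \<delta>), (\<omega>, \<nu>), (U', V', \<delta>'))
    \<in> Arr (fctr_cat (total_cat (A, X, F)) (total_cat (B, Y, G)))"
proof -
  interpret oplax_cell A X F B Y G U V \<delta> U' V' \<delta>' \<omega> \<nu> by fact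
  let ?t = "\<lambda>(a, x, \<xi>) \<in> Obj (total_cat (A, X, F)).
    (total_obj (B, Y, G) (U, V, \<delta>) (a, x, \<xi>), (\<omega> a, \<nu> x), total_obj (B, Y, G) (U', V', \<delta>') (a, x, \<xi>))"
  have alg: "Comp Y (\<nu> x) (Comp Y (FArr V \<xi>) (\<delta> (a, x)))
      = Comp Y (Comp Y (FArr V' \<xi>) (\<delta>' (a, x))) (FArr G (\<omega> a, \<nu> x))"
    if "(a, x, \<xi>) \<in> Obj (total_cat (A, X, F))" for a x \<xi>
    using that by (simp add: \<nu>.square_comp compatible)
  have comp: "?t s \<in> Arr (total_cat (B, Y, G))" if "s \<in> Obj (total_cat (A, X, F))" for s
    using that alg by (cases s) simp
  have "nat_trans (total_cat (A, X, F)) (total_cat (B, Y, G))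
    (total_fctr (A, X, F) (B, Y, G) (U, V, \<delta>)) (total_fctr (A, X, F) (B, Y, G) (U', V', \<delta>')) ?t"
  proof (rule nat_transI, goal_cases)
    case (4 s)
    then show ?case
      using comp [OF 4] by (cases s) simp
  next
    case (5 \<phi>)
    then show ?case
      by (cases \<phi> rule: alg_arr_cases) (simp_all add: \<omega>.square \<nu>.square)
  qed (simp_all add: cat_functor_total_fctr M.oplax_morphism_axioms M'.oplax_morphism_axioms)
  then show ?thesis
    by simp
qed

section \<open>The total category as a 2-functor\<close>

lemma total_fctr_id:
  assumes "parametrized_endofunctor A X F"
  shows "total_fctr (A, X, F) (A, X, F) (oplax_id (A, X, F)) = id_fctr (total_cat (A, X, F))"
proof (rule cat_functor_eqI)
  interpret parametrized_endofunctor A X F by fact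
  show "cat_functor (total_cat (A, X, F)) (total_cat (A, X, F))
      (total_fctr (A, X, F) (A, X, F) (oplax_id (A, X, F)))"
    unfolding oplax_id.simps by (intro cat_functor_total_fctr oplax_morphism_id assms)
  show "cat_functor (total_cat (A, X, F)) (total_cat (A, X, F)) (id_fctr (total_cat (A, X, F)))"
    by (intro cat_functor_id category_total_cat assms)
  have obj: "total_obj (A, X, F) (oplax_id (A, X, F)) s = s" if "s \<in> Obj (total_cat (A, X, F))" for s
    using that by (cases s) (simp add: oplax_id.simps)
  then show "FObj (total_fctr (A, X, F) (A, X, F) (oplax_id (A, X, F))) s
      = FObj (id_fctr (total_cat (A, X, F))) s" if "s \<in> Obj (total_cat (A, X, F))" for s
    using that by simp
  show "FArr (total_fctr (A, X, F) (A, X, F) (oplax_id (A, X, F))) \<phi>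
      = FArr (id_fctr (total_cat (A, X, F))) \<phi>" if "\<phi> \<in> Arr (total_cat (A, X, F))" for \<phi>
    using that by (cases \<phi> rule: alg_arr_cases) (simp_all add: oplax_id.simps)
qed

text \<open>Transporting a structure map in two steps gives \<open>Q(V\<xi> \<delta>) \<epsilon>\<close>, and transporting it along the
  pasted 1-cell gives \<open>QV\<xi> (Q\<delta> \<epsilon>)\<close>: the two agree on the nose, so the assignment is strict.\<close>

lemma total_fctr_comp:
  assumes "oplax_morphism A X F B Y G U V \<delta>" "oplax_morphism B Y G C Z H P Q \<epsilon>"
  shows "total_fctr (A, X, F) (C, Z, H) (oplax_comp (A, X, F) (C, Z, H) (P, Q, \<epsilon>) (U, V, \<delta>))
    = comp_fctr (total_cat (A, X, F)) (total_fctr (B, Y, G) (C, Z, H) (P, Q, \<epsilon>))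
      (total_fctr (A, X, F) (B, Y, G) (U, V, \<delta>))"
proof (rule cat_functor_eqI)
  interpret M: oplax_morphism A X F B Y G U V \<delta> by fact
  interpret N: oplax_morphism B Y G C Z H P Q \<epsilon> by fact
  interpret TM: cat_functor "total_cat (A, X, F)" "total_cat (B, Y, G)"
    "total_fctr (A, X, F) (B, Y, G) (U, V, \<delta>)"
    by (rule cat_functor_total_fctr) fact
  show "cat_functor (total_cat (A, X, F)) (total_cat (C, Z, H))
    (total_fctr (A, X, F) (C, Z, H) (oplax_comp (A, X, F) (C, Z, H) (P, Q, \<epsilon>) (U, V, \<delta>)))"
    unfolding oplax_comp.simps by (intro cat_functor_total_fctr oplax_morphism_comp [OF assms])
  show "cat_functor (total_cat (A, X, F)) (total_cat (C, Z, H))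
    (comp_fctr (total_cat (A, X, F)) (total_fctr (B, Y, G) (C, Z, H) (P, Q, \<epsilon>))
      (total_fctr (A, X, F) (B, Y, G) (U, V, \<delta>)))"
    by (rule cat_functor_comp [OF TM.cat_functor_axioms cat_functor_total_fctr]) fact
  show "FObj (total_fctr (A, X, F) (C, Z, H) (oplax_comp (A, X, F) (C, Z, H) (P, Q, \<epsilon>) (U, V, \<delta>))) s
    = FObj (comp_fctr (total_cat (A, X, F)) (total_fctr (B, Y, G) (C, Z, H) (P, Q, \<epsilon>))
      (total_fctr (A, X, F) (B, Y, G) (U, V, \<delta>))) s" if "s \<in> Obj (total_cat (A, X, F))" for s
    using that TM.obj [OF that] by (cases s) (simp add: oplax_comp.simps)
  show "FArr (total_fctr (A, X, F) (C, Z, H) (oplax_comp (A, X, F) (C, Z, H) (P, Q, \<epsilon>) (U, V, \<delta>))) \<phi>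
    = FArr (comp_fctr (total_cat (A, X, F)) (total_fctr (B, Y, G) (C, Z, H) (P, Q, \<epsilon>))
      (total_fctr (A, X, F) (B, Y, G) (U, V, \<delta>))) \<phi>" if "\<phi> \<in> Arr (total_cat (A, X, F))" for \<phi>
    using that TM.arr(1) [OF that]
    by (cases \<phi> rule: alg_arr_cases) (simp_all add: oplax_comp.simps)
qed

text \<open>The endpoints agree by strictness on 1-cells. The component on either side is the pair
  \<open>(\<psi> P\<omega>, \<chi> Q\<nu>)\<close> with its endpoints, because arrows of the total category are composed
  as pairs.\<close>

lemma total_ntrans_hcomp:
  assumes "oplax_cell A X F B Y G U V \<delta> U' V' \<delta>' \<omega> \<nu>"
    and "oplax_cell B Y G C Z H P Q \<epsilon> P' Q' \<epsilon>' \<psi> \<chi>"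
  shows "total_ntrans (A, X, F) (C, Z, H) (oplax_hcomp_2cell (A, X, F) (C, Z, H)
      ((P, Q, \<epsilon>), (\<psi>, \<chi>), (P', Q', \<epsilon>')) ((U, V, \<delta>), (\<omega>, \<nu>), (U', V', \<delta>')))
    = FArr (HComp Cat (total_cat (A, X, F)) (total_cat (B, Y, G)) (total_cat (C, Z, H)))
      (total_ntrans (B, Y, G) (C, Z, H) ((P, Q, \<epsilon>), (\<psi>, \<chi>), (P', Q', \<epsilon>')),
       total_ntrans (A, X, F) (B, Y, G) ((U, V, \<delta>), (\<omega>, \<nu>), (U', V', \<delta>')))"
proof -
  interpret \<alpha>: oplax_cell A X F B Y G U V \<delta> U' V' \<delta>' \<omega> \<nu> by fact
  interpret \<beta>: oplax_cell B Y G C Z H P Q \<epsilon> P' Q' \<epsilon>' \<psi> \<chi> by fact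
  note fctr = total_fctr_comp [OF \<alpha>.M.oplax_morphism_axioms \<beta>.M.oplax_morphism_axioms]
    total_fctr_comp [OF \<alpha>.M'.oplax_morphism_axioms \<beta>.M'.oplax_morphism_axioms]
  let ?A = "total_cat (A, X, F)" and ?B = "total_cat (B, Y, G)" and ?C = "total_cat (C, Z, H)"
  note nat = nat_trans_total [OF assms(1), simplified] nat_trans_total [OF assms(2), simplified]
  show ?thesis
  proof (simp add: nat oplax_hcomp_2cell.simps fctr,
      rule extensionalityI [of _ "Obj ?A"], goal_cases)
    case (3 s)
    obtain a x \<xi> where s: "s = (a, x, \<xi>)"
      by (cases s) auto
    show ?case
      using 3 nat_trans.component_arr [OF nat(1) 3]
        cat_functor.obj [OF cat_functor_total_fctr [OF \<alpha>.M'.oplax_morphism_axioms] 3]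
      by (simp add: s oplax_comp.simps)
  qed (simp_all add: horiz_comp_def)
qed

lemma total_2functor_simps [simp]:
  "TObj total_2functor = total_cat"
  "M \<in> Obj (oplax_hom k l) \<Longrightarrow> FObj (THom total_2functor k l) M = total_fctr k l M"
  "\<alpha> \<in> Arr (oplax_hom k l) \<Longrightarrow> FArr (THom total_2functor k l) \<alpha> = total_ntrans k l \<alpha>"
  by (auto simp: total_2functor_def)

text \<open>The vertical composite of 2-cells and the composite of the induced transformations both take
  the composites \<open>(\<omega>' \<omega>, \<nu>' \<nu>)\<close> of components, the endpoints being those of the outer 1-cells.\<close>

lemma cat_functor_THom:
  assumes pe: "parametrized_endofunctor A X F" "parametrized_endofunctor B Y G"
  shows "cat_functor (oplax_hom (A, X, F) (B, Y, G))
    (fctr_cat (total_cat (A, X, F)) (total_cat (B, Y, G)))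
    (THom total_2functor (A, X, F) (B, Y, G))"
proof -
  interpret hom: category "oplax_hom (A, X, F) (B, Y, G)"
    by (rule category_oplax_hom [OF pe])
  show ?thesis
  proof (rule cat_functorI, goal_cases)
    case 3 show ?case by (simp add: total_2functor_def)
  next
    case 4 show ?case by (simp add: total_2functor_def)
  next
    case (5 M)
    then show ?case
      using pe by (auto elim!: oplax_hom_ObjE simp: oplax_hom_simps cat_functor_total_fctr)
  next
    case (6 \<alpha>)
    note hom.dom_cod_obj [OF 6]
    with 6 show ?case
      using pe by (auto elim!: oplax_hom_ArrE simp: oplax_hom_simps(3,4)
          simp del: fctr_cat_simps(2) total_ntrans.simps intro: nat_trans_total) simp_all
  next
    case (7 M)
    then obtain U V \<delta> where M: "M = (U, V, \<delta>)" "oplax_morphism A X F B Y G U V \<delta>"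
      using pe by (auto elim!: oplax_hom_ObjE)
    show ?case
      using hom.id_arr(1) [OF 7] 7
      by (auto simp: M(1) oplax_hom_simps(5) [OF pe] fun_eq_iff restrict_def)
  next
    case (8 \<alpha> \<beta>)
    obtain U V \<delta> \<omega> \<nu> U' V' \<delta>' where \<alpha>: "\<alpha> = ((U, V, \<delta>), (\<omega>, \<nu>), (U', V', \<delta>'))"
      using oplax_hom_ArrE [OF 8(1) pe] .
    obtain W W' \<eta> \<omega>' \<nu>' U'' V'' \<delta>'' where \<beta>: "\<beta> = ((W, W', \<eta>), (\<omega>', \<nu>'), (U'', V'', \<delta>''))"
      using oplax_hom_ArrE [OF 8(2) pe] .
    show ?case
      using hom.comp_arr(1) [OF 8] 8
      by (auto simp: \<alpha> \<beta> oplax_hom_simps(3,4,6) [OF pe] fun_eq_iff vert_comp_def restrict_def)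
  qed (simp_all add: category_fctr_cat hom.category_axioms)
qed

lemma two_functor_total_2functor: "two_functor CatCat Cat total_2functor"
proof (intro two_functor.intro two_functor_axioms.intro two_category_CatCat two_category_Cat,
    goal_cases)
  case (3 k)
  then show ?case
    by (auto elim!: param_endosE simp: oplax_id_Obj total_fctr_id)
next
  case (4 k l m M N)
  then show ?case
    by (auto elim!: param_endosE oplax_hom_ObjE
        simp: oplax_hom_simps oplax_comp_Obj total_fctr_comp cat_functor_total_fctr)
next
  case (5 k l m \<alpha> \<beta>)
  then show ?case
    by (auto elim!: param_endosE oplax_hom_ArrE
        simp: oplax_hom_simps oplax_hcomp_2cell_Arr total_ntrans_hcomp
        simp del: total_ntrans.simps)
qed (auto elim!: param_endosE simp: category_total_cat cat_functor_THom)

theorem theorem2p18: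
  shows "two_category
      (CatCat :: (('oa, 'aa, 'ox, 'ax) param_endo, ('oa, 'aa, 'ox, 'ax) oplax,
        ('oa, 'aa, 'ox, 'ax) oplax_2cell) two_cat)
    \<and> two_functor
      (CatCat :: (('oa, 'aa, 'ox, 'ax) param_endo, ('oa, 'aa, 'ox, 'ax) oplax,
        ('oa, 'aa, 'ox, 'ax) oplax_2cell) two_cat)
      (Cat :: (('oa \<times> 'ox \<times> 'ax, ('oa, 'aa, 'ox, 'ax) alg_arr) cat, _, _) two_cat)
      total_2functor"
  using two_category_CatCat two_functor_total_2functor by blast

end
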